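(* Let $L_1,L_2\subseteq\{0,1\}^*$ be languages such that $L_1\le_{\mathrm{M}}^{\mathrm{E},\mathrm{Lb}}L_2$. If $L_1$ is polynomial-time deep, then $L_2$ is polynomial-time deep.
   Context: $s_0=\lambda,s_1,s_2,\dots$ is the standard enumeration of $\{0,1\}^*$ in length-lexicographic order; $x<y$ means $|x|<|y|$, or $|x|=|y|$ and $x$ precedes $y$ alphabetically. A language $L$ is identified with its characteristic sequence $\chi_L$ (the $n$th bit is 1 iff $s_n\in L$); $L\upharpoonright n$ denotes the first $n$ bits of $\chi_L$, and $L(x)\in\{0,1\}$ indicates membership. An oblivious predictor is $P:\{0,1\}^*\times\{0,1\}\to[0,1]$ with $P(x,0)+P(x,1)=1$; it is polynomial-time if $P(s_n,b)$ is computable in time polynomial in $n$; its polynomial-time oblivious martingale (pom) is $p(L\upharpoonright n)=2^n\prod_{y\le s_n}P(y,L(y))$. $L$ is polynomial-time deep if there exists $a>0$ such that for every pom $p$ there is a pom $p'$ with $p'(L\upharpoonright n)/p(L\upharpoonright n)\ge a\log n$ for infinitely many $n$ (convention $1/0=\infty$). A function $f:\{0,1\}^*\to\{0,1\}^*$ is monotone if $x<y\Rightarrow f(x)<f(y)$, and $l$-bounded if $|f(x)|\le l(|x|)$. For $t,l:\mathbb{N}\to\mathbb{N}$, $L_1\le_{\mathrm M}^{t,l}L_2$ means there is a Turing machine computing a monotone $l$-bounded $f$ that on input $s_n$ halts within $t(|s_n|)$ steps, with $s_n\in L_1\iff f(s_n)\in L_2$. $L_1\le_{\mathrm{M}}^{\mathrm{E},\mathrm{Lb}}L_2$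 means there is $c\in\mathbb{N}$ with $L_1\le_{\mathrm M}^{2^{c|s_n|},c|s_n|}L_2$. *)

theory Defs
  imports Complex_Main
begin

definition llex_less :: "bool list \<Rightarrow> bool list \<Rightarrow> bool" where
  "llex_less x y \<longleftrightarrow> length x < length y \<or>
     (length x = length y \<and> (x, y) \<in> lexord {(a, b). a < b})"

definition llex_le :: "bool list \<Rightarrow> bool list \<Rightarrow> bool" where
  "llex_le x y \<longleftrightarrow> llex_less x y \<or> x = y"

definition sidx :: "bool list \<Rightarrow> nat" where
  "sidx x = card {y. llex_less y x}"

definition str :: "nat \<Rightarrow> bool list" where
  "str = inv sidx"

text \<open>Symbols: 0 blank, 1 bit 0, 2 bit 1, 3 separator. State 0 is the start
  state, state 1 the halting state. A transition function maps (state, symbol)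
  to (new state, written symbol, head move).\<close>

type_synonym tm = "nat \<Rightarrow> nat \<Rightarrow> nat \<times> nat \<times> int"
type_synonym config = "nat \<times> (int \<Rightarrow> nat) \<times> int"

definition valid_tm :: "tm \<Rightarrow> bool" where
  "valid_tm \<delta> \<longleftrightarrow> (\<exists>Q S::nat. 2 \<le> Q \<and> 4 \<le> S \<and>
     (\<forall>q<Q. \<forall>a<S. fst (\<delta> q a) < Q \<and> fst (snd (\<delta> q a)) < S
                    \<and> snd (snd (\<delta> q a)) \<in> {-1, 0, 1}))"

definition tm_step :: "tm \<Rightarrow> config \<Rightarrow> config" where
  "tm_step \<delta> c = (case c of (q, tp, h) \<Rightarrow>
     if q = 1 then (q, tp, h)
     else (case \<delta> q (tp h) of (q', a, d) \<Rightarrow> (q', tp(h := a), h + d)))"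

definition tm_init :: "nat list \<Rightarrow> config" where
  "tm_init w = (0, (\<lambda>i. if 0 \<le> i \<and> nat i < length w then w ! nat i else 0), 0)"

definition tm_run :: "tm \<Rightarrow> nat list \<Rightarrow> nat \<Rightarrow> config" where
  "tm_run \<delta> w t = (tm_step \<delta> ^^ t) (tm_init w)"

definition tm_halted :: "config \<Rightarrow> bool" where
  "tm_halted c \<longleftrightarrow> fst c = 1"

definition tm_output :: "config \<Rightarrow> nat list" where
  "tm_output c = (case c of (q, tp, h) \<Rightarrow>
     map (\<lambda>i. tp (int i)) [0..<(LEAST m. tp (int m) = 0)])"

definition enc_bit :: "bool \<Rightarrow> nat" where
  "enc_bit b = (if b then 2 else 1)"

definition enc_str :: "bool list \<Rightarrow> nat list" where
  "enc_str x = map enc_bit x"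

definition bval :: "bool list \<Rightarrow> nat" where
  "bval x = foldl (\<lambda>a b. 2 * a + (if b then 1 else 0)) 0 x"

definition poly_predictor :: "(bool list \<Rightarrow> bool \<Rightarrow> real) \<Rightarrow> bool" where
  "poly_predictor P \<longleftrightarrow>
     (\<forall>x b. 0 \<le> P x b \<and> P x b \<le> 1) \<and> (\<forall>x. P x False + P x True = 1) \<and>
     (\<exists>\<delta> k. valid_tm \<delta> \<and>
        (\<forall>n b. \<exists>t \<le> (n + 2) ^ k.
           tm_halted (tm_run \<delta> (enc_str (str n) @ [3, enc_bit b]) t) \<and>
           (\<exists>u v. tm_output (tm_run \<delta> (enc_str (str n) @ [3, enc_bit b]) t)
                     = enc_str u @ [3] @ enc_str v \<and>
                  0 < bval v \<and> P (str n) b = real (bval u) / real (bval v))))"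

definition pom :: "(bool list \<Rightarrow> bool \<Rightarrow> real) \<Rightarrow> bool list set \<Rightarrow> nat \<Rightarrow> real" where
  "pom P L n = 2 ^ n * (\<Prod>i<n. P (str i) (str i \<in> L))"

definition poly_deep :: "bool list set \<Rightarrow> bool" where
  "poly_deep L \<longleftrightarrow> (\<exists>a::real. a > 0 \<and>
     (\<forall>P. poly_predictor P \<longrightarrow>
        (\<exists>P'. poly_predictor P' \<and>
           infinite {n. pom P L n = 0 \<or> pom P' L n / pom P L n \<ge> a * log 2 (real n)})))"

definition M_reduces :: "(nat \<Rightarrow> nat) \<Rightarrow> (nat \<Rightarrow> nat) \<Rightarrow> bool list set \<Rightarrow> bool list set \<Rightarrow> bool" where
  "M_reduces t l L1 L2 \<longleftrightarrow> (\<exists>\<delta> f. valid_tm \<delta> \<and>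
     (\<forall>x y. llex_less x y \<longrightarrow> llex_less (f x) (f y)) \<and>
     (\<forall>x. length (f x) \<le> l (length x)) \<and>
     (\<forall>x. \<exists>s \<le> t (length x). tm_halted (tm_run \<delta> (enc_str x) s) \<and>
            tm_output (tm_run \<delta> (enc_str x) s) = enc_str (f x)) \<and>
     (\<forall>x. x \<in> L1 \<longleftrightarrow> f x \<in> L2))"

definition M_reduces_E_Lb :: "bool list set \<Rightarrow> bool list set \<Rightarrow> bool" where
  "M_reduces_E_Lb L1 L2 \<longleftrightarrow> (\<exists>c::nat. M_reduces (\<lambda>m. 2 ^ (c * m)) (\<lambda>m. c * m) L1 L2)"

end

theory Submission
  imports Defs
begin

text \<open>
  Let \<open>f\<close> be the reduction and \<open>P\<close> a predictor for \<open>L2\<close>. Then \<open>P \<circ> f\<close> is a predictor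
  for \<open>L1\<close>, hence some \<open>Q\<close> beats it on \<open>L1\<close>. Predict on \<open>L2\<close> with
  \<open>Q \<circ> f\<inverse>\<close> on the range of \<open>f\<close> and with \<open>P\<close> elsewhere. As \<open>f\<close> is
  monotone, the strings below \<open>f x\<close> in the range of \<open>f\<close> are the images of those below \<open>x\<close>,
  so at \<open>f x\<close> the ratio of the two martingales on \<open>L2\<close> equals the ratio on \<open>L1\<close> at \<open>x\<close>,
  and the linear length bound changes the logarithm of the index by a constant factor only.

  Both predictors need Turing machines. They are written in a small while language whose commands
  act on a finite register and the scanned cell of a multi-track tape; the given machines are
  simulated on one track.
\<close>

section \<open>The length-lexicographic enumeration\<close>

text \<open>Predictors are timed by the index of a string, which is \<open>2 ^ length\<close> up to
  a constant factor. On this scale \<open>2 ^ (c * length x)\<close> steps are polynomial in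
  \<open>sidx x\<close>, and so is the index of \<open>f x\<close>, which governs the cost of
  running a predictor there. The same scale makes inverting \<open>f\<close> by brute force
  affordable. The depth constant drops to \<open>a / (2 * c + 1)\<close>, a value that must be fixed
  before \<open>P\<close> is given. The two pairs of martingales agree up to a common factor. If
  this factor vanishes, so does the martingale of \<open>P\<close> on \<open>L2\<close>, and the
  convention for division by zero covers the case. The main labour is effectivity: machines are
  concrete single-tape transition functions with some state and symbol codes fixed in advance, so
  simulation, cleaning up and search need explicit tape layouts and time bounds.\<close>

lemma llex_irrefl: "\<not> llex_less x x"
  by (auto simp: llex_less_def lexord_irreflexive)

lemma llex_trans: "llex_less x y \<Longrightarrow> llex_less y z \<Longrightarrow> llex_less x z"
  unfolding llex_less_def
  by (auto intro: lexord_trans simp: trans_def)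

lemma llex_linear: "llex_less x y \<or> x = y \<or> llex_less y x"
proof -
  have "(x, y) \<in> lexord {(a, b). a < b} \<or> x = y \<or> (y, x) \<in> lexord {(a, b). a < b}"
    by (rule lexord_linear) auto
  then show ?thesis unfolding llex_less_def by (metis linorder_neqE_nat)
qed

lemma llex_length_le: "llex_less x y \<Longrightarrow> length x \<le> length y"
  by (auto simp: llex_less_def)

lemma finite_bool_lists_upto: "finite {y::bool list. length y \<le> n}"
  using finite_lists_length_le[of "UNIV :: bool set" n] by simp

lemma card_bool_lists_upto: "card {y::bool list. length y \<le> n} = 2 ^ (n + 1) - 1"
proof -
  have "card {y::bool list. length y \<le> n} = (\<Sum>i\<le>n. 2 ^ i)"
    using card_lists_length_le[of "UNIV :: bool set" n] by simp
  also have "\<dots> = 2 ^ (n + 1) - 1"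
    using sum_power2[of "Suc n"] by (simp add: lessThan_Suc_atMost atLeast0LessThan)
  finally show ?thesis .
qed

lemma llex_preds_subset: "{y. llex_less y x} \<subseteq> {y. length y \<le> length x} - {x}"
  using llex_length_le llex_irrefl by auto

lemma finite_llex_preds: "finite {y. llex_less y x}"
  using llex_preds_subset finite_bool_lists_upto by (meson finite_Diff finite_subset)

lemma sidx_strict_mono: "llex_less x y \<Longrightarrow> sidx x < sidx y"
  unfolding sidx_def
  by (rule psubset_card_mono[OF finite_llex_preds]) (use llex_trans llex_irrefl in blast)

lemma sidx_less_iff: "sidx x < sidx y \<longleftrightarrow> llex_less x y"
  using sidx_strict_mono llex_linear by (metis less_asym less_irrefl)

lemma inj_sidx: "inj sidx"
  by (rule injI) (metis llex_linear sidx_strict_mono less_irrefl)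

text \<open>Every predecessor is one of the \<open>2 ^ (length x + 1) - 1\<close> strings no longer
  than \<open>x\<close>, and \<open>x\<close> itself is none. Together with
  \<open>sidx_lower\<close> this converts between lengths and indices.\<close>

lemma sidx_upper: "sidx x + 1 < 2 ^ (length x + 1)"
proof -
  have "sidx x \<le> card ({y. length y \<le> length x} - {x})"
    unfolding sidx_def by (rule card_mono[OF _ llex_preds_subset]) (simp add: finite_bool_lists_upto)
  also have "\<dots> = 2 ^ (length x + 1) - 1 - 1"
    by (subst card_Diff_singleton) (auto simp: card_bool_lists_upto[simplified])
  finally have le: "sidx x \<le> 2 ^ (length x + 1) - 1 - 1" .
  have "(2::nat) ^ (length x + 1) \<ge> 2" by simp
  then show ?thesis using le by linarith
qed

lemma sidx_lower: "2 ^ length x \<le> sidx x + 1"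
proof (cases "length x")
  case (Suc k)
  have "card {y::bool list. length y \<le> k} \<le> sidx x"
    unfolding sidx_def
    by (rule card_mono[OF finite_llex_preds]) (auto simp: llex_less_def Suc)
  then show ?thesis unfolding card_bool_lists_upto Suc by simp
qed simp

text \<open>The string of \<open>n\<close> ones has index at least \<open>n\<close>. The indices of
  its predecessors are distinct numbers below its own index, as many as there are such numbers, so
  they leave no gap. Hence \<open>str\<close>, introduced by \<open>inv\<close>, is a genuine
  inverse.\<close>

lemma surj_sidx: "surj sidx"
proof -
  have "n \<in> range sidx" for n
  proof -
    let ?x = "replicate n True" let ?D = "{y. llex_less y ?x}"
    have n: "n \<le> sidx ?x" using sidx_lower[of ?x] less_exp[of n] unfolding length_replicate by linarith
    have "sidx ` ?D \<subseteq> {..<sidx ?x}" using sidx_strict_mono by auto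
    moreover have "card (sidx ` ?D) = sidx ?x"
      using card_image[OF inj_on_subset[OF inj_sidx]] by (simp add: sidx_def)
    ultimately have "sidx ` ?D = {..<sidx ?x}" by (intro card_subset_eq) auto
    then have "n < sidx ?x \<Longrightarrow> n \<in> range sidx" by blast
    then show ?thesis using n by (cases "n = sidx ?x") auto
  qed
  then show ?thesis by auto
qed

lemma sidx_str [simp]: "sidx (str n) = n"
  unfolding str_def by (rule surj_f_inv_f[OF surj_sidx])

lemma str_sidx [simp]: "str (sidx x) = x"
  unfolding str_def by (rule inv_f_f[OF inj_sidx])

lemma length_str_lower: "2 ^ length (str n) \<le> n + 1"
  using sidx_lower[of "str n"] by simp

text \<open>Read on indices, \<open>f\<close> is a strictly increasing map on the naturals and so
  dominates the identity. The length version later confines the search for a preimage of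
  \<open>z\<close> to strings no longer than \<open>z\<close>.\<close>

lemma mono_le_self:
  assumes "\<And>x y. llex_less x y \<Longrightarrow> llex_less (f x) (f y)"
  shows "sidx x \<le> sidx (f x)" and "length x \<le> length (f x)"
proof -
  have sm: "strict_mono (\<lambda>n. sidx (f (str n)))"
    by (rule strict_monoI) (metis assms sidx_less_iff sidx_str)
  show le: "sidx x \<le> sidx (f x)"
    using strict_mono_imp_increasing[OF sm, of "sidx x"] by simp
  show "length x \<le> length (f x)"
    using le sidx_less_iff[of "f x" x] by (auto simp: llex_less_def not_less)
qed

section \<open>A while language for Turing machines\<close>

datatype ('r, 'a) cmd =
    Skip
  | Act "'r \<Rightarrow> 'a \<Rightarrow> 'r \<times> 'a \<times> int"
  | Seq "('r, 'a) cmd" "('r, 'a) cmd"  (infixr ";;" 60)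
  | Cond "'r \<Rightarrow> 'a \<Rightarrow> bool" "('r, 'a) cmd" "('r, 'a) cmd"
  | While "'r \<Rightarrow> 'a \<Rightarrow> bool" "('r, 'a) cmd"

type_synonym ('r, 'a) state = "'r \<times> (int \<Rightarrow> 'a) \<times> int"

text \<open>One machine step in control state (command, register): the remaining command is part of the
  finite control, so a command compiles to a machine without any labels.\<close>

fun nxt :: "('r, 'a) cmd \<Rightarrow> 'r \<Rightarrow> 'a \<Rightarrow> ('r, 'a) cmd \<times> 'r \<times> 'a \<times> int" where
  "nxt Skip r a = (Skip, r, a, 0)"
| "nxt (Act g) r a = (Skip, g r a)"
| "nxt (c1 ;; c2) r a =
    (if c1 = Skip then (c2, r, a, 0) else (case nxt c1 r a of (c1', s) \<Rightarrow> (c1' ;; c2, s)))"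
| "nxt (Cond b c1 c2) r a = (if b r a then c1 else c2, r, a, 0)"
| "nxt (While b c) r a = (if b r a then c ;; While b c else Skip, r, a, 0)"

definition cstep :: "('r, 'a) cmd \<times> ('r, 'a) state \<Rightarrow> ('r, 'a) cmd \<times> ('r, 'a) state" where
  "cstep = (\<lambda>(c, r, tp, h). case nxt c r (tp h) of (c', r', a, d) \<Rightarrow> (c', r', tp(h := a), h + d))"

text \<open>Since \<^const>\<open>Skip\<close> is a fixed point of \<^const>\<open>cstep\<close>, the number \<open>t\<close> is
  only an upper bound for the running time.\<close>

definition exec :: "('r, 'a) cmd \<Rightarrow> ('r, 'a) state \<Rightarrow> nat \<Rightarrow> ('r, 'a) state \<Rightarrow> bool" where
  "exec c s t s' \<longleftrightarrow> (cstep ^^ t) (c, s) = (Skip, s')"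

lemma cstep_Skip [simp]: "cstep (Skip, s) = (Skip, s)"
  by (cases s) (simp add: cstep_def)

lemma funpow_fixpoint: "f x = x \<Longrightarrow> (f ^^ n) x = x"
  by (induction n) auto

lemma exec_mono:
  assumes "exec c s t s'" "t \<le> t'"
  shows "exec c s t' s'"
proof -
  obtain k where "t' = k + t" using assms(2) by (metis add.commute le_Suc_ex)
  then show ?thesis using assms(1) by (simp add: exec_def funpow_add funpow_fixpoint)
qed

lemma exec_step: "cstep (c, s) = (c', s') \<Longrightarrow> exec c' s' t s'' \<Longrightarrow> exec c s (Suc t) s''"
  by (simp add: exec_def funpow_Suc_right del: funpow.simps)

lemma exec_Skip [simp]: "exec Skip s t s' \<longleftrightarrow> s' = s"
  by (auto simp: exec_def funpow_fixpoint)

lemma exec_Act: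
  "g r (tp h) = (r', a, d) \<Longrightarrow> exec (Act g) (r, tp, h) 1 (r', tp(h := a), h + d)"
  by (simp add: exec_def cstep_def)

lemma exec_Seq:
  assumes "exec c1 s t1 s'" "exec c2 s' t2 s''" "t1 + t2 + 1 \<le> t"
  shows "exec (c1 ;; c2) s t s''"
proof -
  have "exec (c1 ;; c2) s (t1 + t2 + 1) s''"
    using assms(1)
  proof (induction t1 arbitrary: c1 s)
    case 0
    then have "c1 = Skip" "s = s'" by (auto simp: exec_def)
    then show ?case using assms(2)
      by (cases s) (auto intro!: exec_step[where c' = c2 and s' = s'] simp: cstep_def)
  next
    case (Suc t1)
    show ?case
    proof (cases "c1 = Skip")
      \<comment> \<open>As \<open>t1\<close> is only an upper bound, \<open>c1\<close> may be
        finished before its time is used up.\<close>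
      case True
      then have "s = s'" using Suc.prems by simp
      then have "exec (c1 ;; c2) s (Suc t2) s''" using assms(2) True
        by (cases s) (auto intro!: exec_step[where c' = c2 and s' = s'] simp: cstep_def)
      then show ?thesis by (rule exec_mono) simp
    next
      case False
      obtain c1' u where u: "cstep (c1, s) = (c1', u)" by (cases "cstep (c1, s)")
      then have "exec c1' u t1 s'" using Suc.prems
        by (simp add: exec_def funpow_Suc_right del: funpow.simps)
      then have "exec (c1' ;; c2) u (t1 + t2 + 1) s''" by (rule Suc.IH)
      moreover have "cstep (c1 ;; c2, s) = (c1' ;; c2, u)"
        using u False by (cases s) (auto simp: cstep_def split: prod.splits)
      ultimately show ?thesis using exec_step by fastforce
    qed
  qed
  then show ?thesis using assms(3) by (rule exec_mono)
qed

lemma exec_Cond: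
  assumes "if b r (tp h) then exec c1 (r, tp, h) t s' else exec c2 (r, tp, h) t s'"
  shows "exec (Cond b c1 c2) (r, tp, h) (t + 1) s'"
  using assms unfolding Suc_eq_plus1[symmetric]
  by (intro exec_step[where c' = "if b r (tp h) then c1 else c2" and s' = "(r, tp, h)"])
    (auto simp: cstep_def)

lemma exec_While_False:
  "\<not> b r (tp h) \<Longrightarrow> 1 \<le> t \<Longrightarrow> exec (While b c) (r, tp, h) t (r, tp, h)"
  by (rule exec_mono[where t = 1]) (simp_all add: exec_def cstep_def)

text \<open>The two extra steps are the successful test and the removal of the finished body from
  the sequence.\<close>

lemma exec_While_True:
  assumes "b r (tp h)" "exec c (r, tp, h) t1 s'" "exec (While b c) s' t2 s''"
  shows "exec (While b c) (r, tp, h) (t1 + t2 + 2) s''"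
proof -
  have "exec (c ;; While b c) (r, tp, h) (t1 + t2 + 1) s''"
    by (rule exec_Seq[OF assms(2,3)]) simp
  then have "exec (While b c) (r, tp, h) (Suc (t1 + t2 + 1)) s''"
    by (rule exec_step[rotated]) (use assms(1) in \<open>simp add: cstep_def\<close>)
  then show ?thesis by simp
qed

section \<open>Compiling commands to Turing machines\<close>

fun wf_cmd :: "'r set \<Rightarrow> 'a set \<Rightarrow> ('r, 'a) cmd \<Rightarrow> bool" where
  "wf_cmd R A Skip = True"
| "wf_cmd R A (Act g) = (\<forall>r\<in>R. \<forall>a\<in>A. g r a \<in> R \<times> A \<times> {-1, 0, 1})"
| "wf_cmd R A (c1 ;; c2) = (wf_cmd R A c1 \<and> wf_cmd R A c2)"
| "wf_cmd R A (Cond b c1 c2) = (wf_cmd R A c1 \<and> wf_cmd R A c2)"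
| "wf_cmd R A (While b c) = wf_cmd R A c"

text \<open>A finite set of remaining commands that is closed under steps; with the finitely many
  registers it yields the state set of the compiled machine.\<close>

fun reach :: "('r, 'a) cmd \<Rightarrow> ('r, 'a) cmd set" where
  "reach Skip = {Skip}"
| "reach (Act g) = {Act g, Skip}"
| "reach (c1 ;; c2) = (\<lambda>c. c ;; c2) ` reach c1 \<union> reach c2"
| "reach (Cond b c1 c2) = {Cond b c1 c2} \<union> reach c1 \<union> reach c2"
| "reach (While b c) = {While b c, Skip} \<union> (\<lambda>c'. c' ;; While b c) ` reach c"

lemma finite_reach: "finite (reach c)"
  by (induction c) auto

lemma reach_refl: "c \<in> reach c"
  by (induction c) auto

lemma nxt_reach: "c' \<in> reach c \<Longrightarrow> fst (nxt c' r a) \<in> reach c"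
proof (induction c arbitrary: c')
  case (Seq c1 c2)
  from Seq.prems consider d where "c' = d ;; c2" "d \<in> reach c1" | "c' \<in> reach c2" by auto
  then show ?case
  proof cases
    case 1
    then show ?thesis using Seq.IH(1)[of d] reach_refl[of c2] by (auto split: prod.splits)
  qed (use Seq.IH in auto)
next
  case (While b c)
  from While.prems consider "c' \<in> {While b c, Skip}" | d where "c' = d ;; While b c" "d \<in> reach c"
    by auto
  then show ?case
  proof cases
    case 2
    then show ?thesis using While.IH[of d] by (auto split: prod.splits)
  qed (use reach_refl[of c] in auto)
qed (auto simp: reach_refl)

lemma wf_reach: "c' \<in> reach c \<Longrightarrow> wf_cmd R A c \<Longrightarrow> wf_cmd R A c'"
proof (induction c arbitrary: c')
  case (Seq c1 c2)
  from Seq.prems(1) consider d where "c' = d ;; c2" "d \<in> reach c1" | "c' \<in> reach c2" by auto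
  then show ?case using Seq.IH Seq.prems(2) by cases (simp_all only: wf_cmd.simps)
next
  case (Cond b c1 c2)
  from Cond.prems(1) consider "c' = Cond b c1 c2" | "c' \<in> reach c1" | "c' \<in> reach c2" by auto
  then show ?case using Cond.IH Cond.prems(2) by cases (simp_all only: wf_cmd.simps)
next
  case (While b c)
  from While.prems(1) consider "c' = While b c" | "c' = Skip" | d where "c' = d ;; While b c" "d \<in> reach c"
    by auto
  then show ?case using While.IH While.prems(2) by cases (simp_all only: wf_cmd.simps)
qed auto

lemma nxt_wf:
  assumes "r \<in> R" "a \<in> A"
  shows "wf_cmd R A c \<Longrightarrow> snd (nxt c r a) \<in> R \<times> A \<times> {-1, 0, 1}"
proof (induction c)
  case Skip
  show ?case using assms by simp
next
  case (Act g)
  then have "g r a \<in> R \<times> A \<times> {-1, 0, 1}"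
    using assms unfolding wf_cmd.simps by blast
  then show ?case unfolding nxt.simps snd_conv .
next
  case (Seq c1 c2)
  then have IH: "snd (nxt c1 r a) \<in> R \<times> A \<times> {-1, 0, 1}" by simp
  show ?case
  proof (cases "c1 = Skip")
    case False
    then have "snd (nxt (c1 ;; c2) r a) = snd (nxt c1 r a)" by (simp split: prod.split)
    then show ?thesis using IH by simp
  qed (use assms in simp)
next
  case (Cond b c1 c2)
  show ?case using assms by simp
next
  case (While b c)
  show ?case using assms by simp
qed

text \<open>The initial tape of \<open>tm_init\<close>, named because it also describes the contents
  of single tracks.\<close>

definition tape_of :: "nat list \<Rightarrow> int \<Rightarrow> nat" where
  "tape_of w i = (if 0 \<le> i \<and> nat i < length w then w ! nat i else 0)"

lemma tm_run_0: "tm_run \<delta> w 0 = (0, tape_of w, 0)"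
  by (simp add: tm_run_def tm_init_def tape_of_def fun_eq_iff)

lemma tm_run_Suc: "tm_run \<delta> w (Suc t) = tm_step \<delta> (tm_run \<delta> w t)"
  by (simp add: tm_run_def)

text \<open>The control states of the machine are pairs of a remaining command and a register. The
  conclusion prescribes only the output cells and the blank behind them, so a program may leave
  marks elsewhere.\<close>

lemma compile_cmd:
  fixes c :: "('r, 'a) cmd" and plain :: "nat \<Rightarrow> 'a"
  assumes fin: "finite R" "finite A" and wf: "wf_cmd R A c" and r0: "r0 \<in> R"
    and plain: "inj_on plain {..<4}" "plain ` {..<4} \<subseteq> A" and c: "c \<noteq> Skip"
  shows "\<exists>\<delta>. valid_tm \<delta> \<and> (\<forall>w t r tp h. set w \<subseteq> {..<4} \<longrightarrow>
      exec c (r0, \<lambda>i. plain (tape_of w i), 0) t (r, tp, h) \<longrightarrow>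
      tm_halted (tm_run \<delta> w t) \<and>
      (\<forall>out. set out \<subseteq> {1..<4} \<longrightarrow> (\<forall>i<length out. tp (int i) = plain (out ! i)) \<longrightarrow>
          tp (int (length out)) = plain 0 \<longrightarrow> tm_output (tm_run \<delta> w t) = out))"
proof -
  let ?C = "reach c \<times> R"
  have finC: "finite ?C" using fin finite_reach by blast
  obtain ns :: "('r, 'a) cmd \<times> 'r \<Rightarrow> nat" and na :: "'a \<Rightarrow> nat"
    where ns: "inj_on ns ?C" and na: "inj_on na A"
    using finite_imp_inj_to_nat_seg[OF finC] finite_imp_inj_to_nat_seg[OF fin(2)] by blast
  \<comment> \<open>Codes 0 and 1 are reserved for start and halt. All pairs with
    \<open>Skip\<close> share code 1, so \<open>es\<close> is injective only on unfinished
    configurations; \<open>c \<noteq> Skip\<close> keeps the two reserved codes apart.\<close>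
  define es where "es = (\<lambda>(d, r). if d = Skip then 1
      else if (d, r) = (c, r0) then 0 else 2 + ns (d, r))"
  \<comment> \<open>Symbols 0 to 3 are fixed by the encoding of inputs and outputs, so plain cells
    keep these codes and all others move to 4 and above.\<close>
  define ea where "ea x = (if x \<in> plain ` {..<4} then inv_into {..<4} plain x
      else 4 + na x)" for x
  have es1: "es p = 1 \<longleftrightarrow> fst p = Skip" for p by (auto simp: es_def split: prod.splits)
  have es_inj: "p = p'" if "p \<in> ?C" "p' \<in> ?C" "es p = es p'" "fst p \<noteq> Skip" for p p'
    using that c ns
    by (auto simp: es_def inj_on_eq_iff split: prod.splits if_splits)
  have ea_pure: "ea (plain k) = k" if "k < 4" for k
    using that plain(1) by (simp add: ea_def)
  have ea_ge: "ea x \<ge> 4" if "x \<notin> plain ` {..<4}" for x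
    using that by (simp add: ea_def)
  have ea_inj: "x = y" if "x \<in> A" "y \<in> A" "ea x = ea y" for x y
    using that na ea_pure ea_ge
    by (cases "x \<in> plain ` {..<4}"; cases "y \<in> plain ` {..<4}")
      (auto simp: ea_def inj_on_eq_iff)
  \<comment> \<open>Codes that belong to no configuration lead to the halting state, which keeps the
    transition function in range everywhere.\<close>
  define \<delta> :: tm where "\<delta> q b = (if q \<noteq> 1 \<and> q \<in> es ` ?C \<and> b \<in> ea ` A then
        (let p = inv_into ?C es q; (d', r', a', m) = nxt (fst p) (snd p) (inv_into A ea b)
         in (es (d', r'), ea a', m))
      else (1, 0, 0))" for q b
  have \<delta>: "\<delta> (es (d, r)) (ea a) = (let (d', r', a', m) = nxt d r a in (es (d', r'), ea a', m))"
    if "d \<in> reach c" "r \<in> R" "a \<in> A" "d \<noteq> Skip" for d r a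
  proof -
    have "inv_into ?C es (es (d, r)) = (d, r)"
      by (rule es_inj[symmetric]) (use that in \<open>auto intro!: inv_into_into f_inv_into_f[symmetric] simp del: mem_Sigma_iff\<close>)
    moreover have "inv_into A ea (ea a) = a"
      by (rule ea_inj) (use that in \<open>auto intro!: inv_into_into f_inv_into_f\<close>)
    ultimately show ?thesis using that es1[of "(d, r)"] by (auto simp: \<delta>_def)
  qed
  define Q where "Q = Suc (Suc (Max (es ` ?C)))"
  define S where "S = 4 + Suc (Max (ea ` A))"
  have Q: "es p < Q" if "p \<in> ?C" for p
    unfolding Q_def less_Suc_eq_le by (rule le_SucI[OF Max_ge]) (use finC that in auto)
  have S: "ea a < S" if "a \<in> A" for a
    unfolding S_def add_Suc_right less_Suc_eq_le by (rule trans_le_add2[OF Max_ge]) (use fin that in auto)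
  have step_in: "fst (nxt d r a) \<in> reach c \<and> snd (nxt d r a) \<in> R \<times> A \<times> {-1, 0, 1}"
    if "d \<in> reach c" "r \<in> R" "a \<in> A" for d r a
    using nxt_reach[OF that(1)] nxt_wf[OF that(2,3) wf_reach[OF that(1) wf]] by blast
  have "fst (\<delta> q b) < Q \<and> fst (snd (\<delta> q b)) < S \<and> snd (snd (\<delta> q b)) \<in> {-1, 0, 1}" for q b
  proof (cases "q \<noteq> 1 \<and> q \<in> es ` ?C \<and> b \<in> ea ` A")
    case True
    then obtain d r a where *: "q = es (d, r)" "d \<in> reach c" "r \<in> R" "b = ea a" "a \<in> A" "d \<noteq> Skip"
      using es1 by auto
    obtain d' r' a' m where n: "nxt d r a = (d', r', a', m)" by (metis prod_cases4)
    show ?thesis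
      using \<delta>[OF *(2,3,5,6)] step_in[OF *(2,3,5)] Q[of "(d', r')"] S[of a'] n * by auto
  next
    case False
    then show ?thesis by (auto simp: \<delta>_def Q_def S_def)
  qed
  moreover have "2 \<le> Q" "4 \<le> S" by (auto simp: Q_def S_def)
  ultimately have valid: "valid_tm \<delta>" unfolding valid_tm_def by blast
  \<comment> \<open>Command and machine run in lockstep, one machine step per \<open>cstep\<close>,
    and both stand still once \<open>Skip\<close> is reached.\<close>
  have sim: "case (cstep ^^ t) (c, r0, \<lambda>i. plain (tape_of w i), 0) of (d, r, tp, h) \<Rightarrow>
      d \<in> reach c \<and> r \<in> R \<and> range tp \<subseteq> A \<and> tm_run \<delta> w t = (es (d, r), \<lambda>i. ea (tp i), h)"
    if w: "set w \<subseteq> {..<4}" for w t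
  proof (induction t)
    case 0
    have "tape_of w i < 4" for i using w by (auto simp: tape_of_def subset_iff)
    then show ?case using plain(2) r0 c ea_pure
      by (auto simp: reach_refl tm_run_0 es_def image_subset_iff)
  next
    case (Suc t)
    obtain d r tp h where e: "(cstep ^^ t) (c, r0, \<lambda>i. plain (tape_of w i), 0) = (d, r, tp, h)"
      by (metis prod_cases4)
    with Suc have *: "d \<in> reach c" "r \<in> R" "range tp \<subseteq> A"
      "tm_run \<delta> w t = (es (d, r), \<lambda>i. ea (tp i), h)" by auto
    obtain d' r' a' m where n: "nxt d r (tp h) = (d', r', a', m)" by (metis prod_cases4)
    show ?case
    proof (cases "d = Skip")
      case True
      then show ?thesis using e * by (auto simp: tm_run_Suc tm_step_def es_def)
    next
      case False
      have "tp h \<in> A" using * by auto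
      then show ?thesis using \<delta>[OF *(1,2) _ False, of "tp h"] step_in[OF *(1,2), of "tp h"] e * n False
          es1[of "(d, r)"]
        by (auto simp: tm_run_Suc tm_step_def cstep_def fun_eq_iff image_subset_iff)
    qed
  qed
  show ?thesis
  proof (intro exI[of _ \<delta>] conjI valid allI impI)
    fix w t r tp h
    assume w: "set w \<subseteq> {..<4}" and ex: "exec c (r0, \<lambda>i. plain (tape_of w i), 0) t (r, tp, h)"
    have run: "tm_run \<delta> w t = (1, \<lambda>i. ea (tp i), h)" and A: "range tp \<subseteq> A"
      using sim[OF w, of t] ex by (auto simp: exec_def es_def)
    show "tm_halted (tm_run \<delta> w t)" by (simp add: run tm_halted_def)
    fix out
    assume o: "set out \<subseteq> {1..<4}" "\<forall>i<length out. tp (int i) = plain (out ! i)"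
      "tp (int (length out)) = plain 0"
    have nth: "ea (tp (int i)) = out ! i" "ea (tp (int i)) \<noteq> 0" if "i < length out" for i
    proof -
      have "out ! i \<in> {1..<4}" using o(1) that nth_mem by blast
      then show "ea (tp (int i)) = out ! i" "ea (tp (int i)) \<noteq> 0"
        using o(2) ea_pure that by auto
    qed
    have Least: "(LEAST m. ea (tp (int m)) = 0) = length out"
    proof (rule Least_equality)
      show "ea (tp (int (length out))) = 0" using o(3) ea_pure by simp
      show "length out \<le> y" if "ea (tp (int y)) = 0" for y
        using nth(2)[of y] that by (cases "y < length out") auto
    qed
    have "tm_output (tm_run \<delta> w t) = map (\<lambda>i. ea (tp (int i))) [0..<length out]"
      by (simp only: run tm_output_def prod.case Least)
    also have "\<dots> = out"
      by (rule nth_equalityI) (simp_all add: nth(1))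
    finally show "tm_output (tm_run \<delta> w t) = out" .
  qed
qed

section \<open>Simulating machines on a multi-track tape\<close>

text \<open>\<open>st\<close> is the state of a simulated machine and \<open>sym\<close> the bit to
  be predicted. \<open>flag\<close> is the status of the search: 0 while running, 1 when a preimage
  is found, 2 when the candidates are exhausted.\<close>

record reg = st :: nat  sym :: nat  flag :: nat

text \<open>Three tracks on one tape: the input, a counter string, and the work tape of simulated machines.
  The flag \<open>org\<close> marks position 0, and \<open>vis\<close> marks the interval that a simulated machine
  has touched, so that it can be wiped afterwards.\<close>

record cell = inp :: nat  ctr :: nat  wrk :: nat  org :: bool  vis :: bool

type_synonym prog = "(reg, cell) cmd"

text \<open>The cell standing for a bare machine symbol; inputs arrive and outputs must be left in
  this form.\<close>

definition plain :: "nat \<Rightarrow> cell" where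
  "plain k = \<lparr>inp = k, ctr = 0, wrk = 0, org = False, vis = False\<rparr>"

definition mk :: "(int \<Rightarrow> nat) \<Rightarrow> (int \<Rightarrow> nat) \<Rightarrow> (int \<Rightarrow> nat) \<Rightarrow> int set \<Rightarrow> int \<Rightarrow> cell" where
  "mk I X W V i = \<lparr>inp = I i, ctr = X i, wrk = W i, org = (i = 0), vis = (i \<in> V)\<rparr>"

lemma mk_simps [simp]:
  "inp (mk I X W V i) = I i" "ctr (mk I X W V i) = X i" "wrk (mk I X W V i) = W i"
  "org (mk I X W V i) \<longleftrightarrow> i = 0" "vis (mk I X W V i) \<longleftrightarrow> i \<in> V"
  by (simp_all add: mk_def)

section \<open>Elementary movements on the tape\<close>

definition sweep :: "(cell \<Rightarrow> bool) \<Rightarrow> (cell \<Rightarrow> cell) \<Rightarrow> int \<Rightarrow> prog" where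
  "sweep b F d = While (\<lambda>r. b) (Act (\<lambda>r a. (r, F a, d)))"

text \<open>Each cell costs three steps, namely the test, the action and the removal of the finished
  action; the failing test adds one.\<close>

lemma exec_sweep_right:
  assumes "\<And>j. h \<le> j \<Longrightarrow> j < h + int n \<Longrightarrow> b (tp j)" "\<not> b (tp (h + int n))"
  shows "exec (sweep b F 1) (r, tp, h) (3 * n + 1)
    (r, \<lambda>j. if h \<le> j \<and> j < h + int n then F (tp j) else tp j, h + int n)"
  using assms
proof (induction n arbitrary: h tp)
  case 0
  have "(\<lambda>j. if h \<le> j \<and> j < h + int 0 then F (tp j) else tp j) = tp" by (auto simp: fun_eq_iff)
  then show ?case using 0 unfolding sweep_def by (simp add: exec_While_False)
next
  case (Suc n)
  let ?tp = "tp(h := F (tp h))"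
  have "exec (Act (\<lambda>r a. (r, F a, 1))) (r, tp, h) 1 (r, ?tp, h + 1)"
    by (rule exec_Act) simp
  moreover have "exec (sweep b F 1) (r, ?tp, h + 1) (3 * n + 1)
    (r, \<lambda>j. if h + 1 \<le> j \<and> j < h + 1 + int n then F (?tp j) else ?tp j, h + 1 + int n)"
    by (rule Suc.IH) (use Suc.prems in \<open>auto simp: add_ac\<close>)
  moreover have "(\<lambda>j. if h + 1 \<le> j \<and> j < h + 1 + int n then F (?tp j) else ?tp j)
      = (\<lambda>j. if h \<le> j \<and> j < h + int (Suc n) then F (tp j) else tp j)"
    by (auto simp: fun_eq_iff)
  ultimately have "exec (sweep b F 1) (r, tp, h) (1 + (3 * n + 1) + 2)
      (r, \<lambda>j. if h \<le> j \<and> j < h + int (Suc n) then F (tp j) else tp j, h + 1 + int n)"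
    unfolding sweep_def by (intro exec_While_True) (use Suc.prems(1)[of h] in auto)
  moreover have "1 + (3 * n + 1) + 2 = 3 * Suc n + 1" "h + 1 + int n = h + int (Suc n)" by simp_all
  ultimately show ?case by (simp only:)
qed

lemma exec_sweep_to:
  assumes "\<And>j. h \<le> j \<Longrightarrow> j < k \<Longrightarrow> b (tp j)" "\<not> b (tp k)" "h \<le> k" "3 * nat (k - h) + 1 \<le> t"
    and "\<And>j. tp' j = (if h \<le> j \<and> j < k then F (tp j) else tp j)"
  shows "exec (sweep b F 1) (r, tp, h) t (r, tp', k)"
proof -
  have "tp' = (\<lambda>j. if h \<le> j \<and> j < k then F (tp j) else tp j)" using assms(5) by auto
  then show ?thesis
    using exec_sweep_right[of h "nat (k - h)" b tp F r] assms(1-4) by (auto intro: exec_mono)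
qed

lemma exec_sweep_left:
  assumes "\<And>j. k < j \<Longrightarrow> j \<le> h \<Longrightarrow> b (tp j)" "\<not> b (tp k)" "k \<le> h" "3 * nat (h - k) + 1 \<le> t"
  shows "exec (sweep b id (- 1)) (r, tp, h) t (r, tp, k)"
proof -
  have "exec (sweep b id (- 1)) (r, tp, k + int n) (3 * n + 1) (r, tp, k)"
    if "k + int n \<le> h" for n
    using that
  proof (induction n)
    case 0
    then show ?case unfolding sweep_def using assms(2) by (simp add: exec_While_False)
  next
    case (Suc n)
    have "exec (Act (\<lambda>r a. (r, id a, - 1))) (r, tp, k + int (Suc n)) 1
        (r, tp(k + int (Suc n) := id (tp (k + int (Suc n)))), k + int (Suc n) + - 1)"
      by (rule exec_Act) simp
    moreover have "k + int (Suc n) + - 1 = k + int n" by simp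
    ultimately have "exec (sweep b id (- 1)) (r, tp, k + int (Suc n)) (1 + (3 * n + 1) + 2) (r, tp, k)"
      unfolding sweep_def
      by (intro exec_While_True) (use Suc assms(1) in \<open>auto simp: sweep_def\<close>)
    then show ?case by (rule exec_mono) simp
  qed
  from this[of "nat (h - k)"] show ?thesis using assms(3,4) by (auto intro: exec_mono)
qed

lemma exec_Act':
  assumes "g r (tp h) = (r1, a, d)" "r' = r1" "tp' = tp(h := a)" "h' = h + d" "1 \<le> t"
  shows "exec (Act g) (r, tp, h) t (r', tp', h')"
  using exec_mono[OF exec_Act[of g r tp h, OF assms(1)] assms(5)] assms(2-4) by simp

abbreviation home :: prog where "home \<equiv> sweep (\<lambda>a. \<not> org a) id (- 1)"

text \<open>The input consists of a string, the separator 3 and a bit. Stripping the suffix leaves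
  the string alone on its track, while the bit survives in the register. The origin is marked first
  so that \<open>home\<close> can find it.\<close>

definition read_input :: prog where
  "read_input = Act (\<lambda>r a. (r, a\<lparr>org := True\<rparr>, 0)) ;; sweep (\<lambda>a. inp a \<noteq> 3) id 1 ;;
     Act (\<lambda>r a. (r, a\<lparr>inp := 0\<rparr>, 1)) ;; Act (\<lambda>r a. (r\<lparr>sym := inp a\<rparr>, a\<lparr>inp := 0\<rparr>, 0)) ;; home"

lemma exec_read_input:
  assumes "3 \<notin> set u"
  shows "exec read_input (r, \<lambda>i. plain (tape_of (u @ [3, b]) i), 0) (6 * length u + 12)
     (r\<lparr>sym := b\<rparr>, mk (tape_of u) (\<lambda>_. 0) (\<lambda>_. 0) {}, 0)"
proof -
  let ?T = "\<lambda>w. mk (tape_of w) (\<lambda>_. 0) (\<lambda>_. 0) {}" and ?n = "int (length u)"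
  have nu: "u ! nat j \<noteq> 3" if "0 \<le> j" "j < ?n" for j
  proof -
    have "u ! nat j \<in> set u" using that by (auto intro: nth_mem)
    then show ?thesis using assms by metis
  qed
  have tl: "tape_of (u @ [3, b]) = (tape_of u)(?n := 3, ?n + 1 := b)"
    "tape_of u ?n = 0" "tape_of u (?n + 1) = 0"
    by (auto simp: tape_of_def fun_eq_iff nth_append nth_Cons split: nat.splits)
  have "exec (Act (\<lambda>r a. (r, a\<lparr>org := True\<rparr>, 0))) (r, \<lambda>i. plain (tape_of (u @ [3, b]) i), 0) 1
      (r, ?T (u @ [3, b]), 0)"
    by (rule exec_Act', rule refl) (auto simp: fun_eq_iff mk_def plain_def)
  moreover have "exec (sweep (\<lambda>a. inp a \<noteq> 3) id 1) (r, ?T (u @ [3, b]), 0) (3 * length u + 1)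
      (r, ?T (u @ [3, b]), ?n)"
    by (rule exec_sweep_to) (use nu in \<open>auto simp: tape_of_def nth_append\<close>)
  moreover have "exec (Act (\<lambda>r a. (r, a\<lparr>inp := 0\<rparr>, 1))) (r, ?T (u @ [3, b]), ?n) 1
      (r, mk ((tape_of u)(?n + 1 := b)) (\<lambda>_. 0) (\<lambda>_. 0) {}, ?n + 1)"
    by (rule exec_Act', rule refl) (auto simp: fun_eq_iff mk_def tl)
  moreover have "exec (Act (\<lambda>r a. (r\<lparr>sym := inp a\<rparr>, a\<lparr>inp := 0\<rparr>, 0)))
      (r, mk ((tape_of u)(?n + 1 := b)) (\<lambda>_. 0) (\<lambda>_. 0) {}, ?n + 1) 1
      (r\<lparr>sym := b\<rparr>, ?T u, ?n + 1)"
    by (rule exec_Act', rule refl) (auto simp: fun_eq_iff mk_def tl)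
  moreover have "exec home (r\<lparr>sym := b\<rparr>, ?T u, ?n + 1) (3 * length u + 4) (r\<lparr>sym := b\<rparr>, ?T u, 0)"
    by (rule exec_sweep_left) auto
  ultimately show ?thesis unfolding read_input_def
    by (intro exec_Seq[where ?t2.0 = "6 * length u + 10"] exec_Seq[where ?t2.0 = "3 * length u + 8"]
        exec_Seq[where ?t2.0 = "3 * length u + 6"] exec_Seq) (assumption | simp)+
qed

text \<open>With \<open>suf\<close> the separator and the stored bit are appended, which is the
  input format of predictors. The cell behind the word is marked too, so that the visited interval
  contains the origin even if the word is empty.\<close>

definition load :: "(cell \<Rightarrow> nat) \<Rightarrow> bool \<Rightarrow> prog" where
  "load sel suf = sweep (\<lambda>a. sel a \<noteq> 0) (\<lambda>a. a\<lparr>wrk := sel a, vis := True\<rparr>) 1 ;;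
     (if suf then Act (\<lambda>r a. (r, a\<lparr>wrk := 3, vis := True\<rparr>, 1)) ;;
        Act (\<lambda>r a. (r, a\<lparr>wrk := sym r, vis := True\<rparr>, 1)) else Skip) ;;
     Act (\<lambda>r a. (r, a\<lparr>vis := True\<rparr>, 0)) ;; home"

lemma tape_of_nonzero:
  assumes "0 \<notin> set u" "0 \<le> j" "j < int (length u)"
  shows "tape_of u j \<noteq> 0"
proof -
  have "u ! nat j \<in> set u" using assms by simp
  then show ?thesis using assms by (metis tape_of_def nat_less_iff)
qed

lemma tape_of_end: "int (length u) \<le> j \<Longrightarrow> tape_of u j = 0"
  by (auto simp: tape_of_def)

lemma exec_load:
  assumes u: "0 \<notin> set u" and sel: "\<And>W V i. sel (mk I X W V i) = tape_of u i"
    and w: "w = (if suf then u @ [3, sym r] else u)"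
  shows "exec (load sel suf) (r, mk I X (\<lambda>_. 0) {}, 0) (6 * length w + 9)
     (r, mk I X (tape_of w) {0..int (length w)}, 0)"
proof -
  let ?n = "int (length u)" and ?m = "int (length w)"
  have "exec (sweep (\<lambda>a. sel a \<noteq> 0) (\<lambda>a. a\<lparr>wrk := sel a, vis := True\<rparr>) 1)
      (r, mk I X (\<lambda>_. 0) {}, 0) (3 * length u + 1) (r, mk I X (tape_of u) {0..<?n}, ?n)"
  proof (rule exec_sweep_to)
    fix j
    show "sel (mk I X (\<lambda>_. 0) {} j) \<noteq> 0" if "0 \<le> j" "j < ?n"
      unfolding sel using u that by (rule tape_of_nonzero)
    show "mk I X (tape_of u) {0..<?n} j = (if 0 \<le> j \<and> j < ?n
      then (mk I X (\<lambda>_. 0) {} j)\<lparr>wrk := sel (mk I X (\<lambda>_. 0) {} j), vis := True\<rparr>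
      else mk I X (\<lambda>_. 0) {} j)"
      unfolding sel by (auto simp: mk_def tape_of_def)
  qed (auto simp: sel tape_of_end)
  moreover have "exec (if suf then Act (\<lambda>r a. (r, a\<lparr>wrk := 3, vis := True\<rparr>, 1)) ;;
        Act (\<lambda>r a. (r, a\<lparr>wrk := sym r, vis := True\<rparr>, 1)) else Skip)
      (r, mk I X (tape_of u) {0..<?n}, ?n) (3 * (length w - length u)) (r, mk I X (tape_of w) {0..<?m}, ?m)"
  proof (cases suf)
    case True
    have tl: "tape_of (u @ [3, sym r]) = (tape_of u)(?n := 3, ?n + 1 := sym r)"
      by (auto simp: tape_of_def fun_eq_iff nth_append nth_Cons split: nat.splits)
    have "exec (Act (\<lambda>r a. (r, a\<lparr>wrk := 3, vis := True\<rparr>, 1)))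
        (r, mk I X (tape_of u) {0..<?n}, ?n) 1
        (r, mk I X ((tape_of u)(?n := 3)) {0..<?n + 1}, ?n + 1)"
      by (rule exec_Act', rule refl) (auto simp: fun_eq_iff mk_def)
    moreover have "exec (Act (\<lambda>r a. (r, a\<lparr>wrk := sym r, vis := True\<rparr>, 1)))
        (r, mk I X ((tape_of u)(?n := 3)) {0..<?n + 1}, ?n + 1) 1
        (r, mk I X (tape_of w) {0..<?m}, ?m)"
      by (rule exec_Act', rule refl) (auto simp: fun_eq_iff mk_def w True tl)
    ultimately show ?thesis using True w by (auto intro: exec_Seq)
  qed (auto simp: w)
  moreover have "exec (Act (\<lambda>r a. (r, a\<lparr>vis := True\<rparr>, 0))) (r, mk I X (tape_of w) {0..<?m}, ?m) 1
      (r, mk I X (tape_of w) {0..?m}, ?m)"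
    by (rule exec_Act', rule refl) (auto simp: fun_eq_iff mk_def)
  moreover have "exec home (r, mk I X (tape_of w) {0..?m}, ?m) (3 * length w + 1)
      (r, mk I X (tape_of w) {0..?m}, 0)"
    by (rule exec_sweep_left) auto
  moreover have "3 * length u + 3 * (length w - length u) = 3 * length w"
    by (auto simp: w)
  ultimately show ?thesis unfolding load_def
    by (intro exec_Seq[where ?t2.0 = "3 * (length w - length u) + 3 * length w + 4"]
         exec_Seq[where ?t2.0 = "3 * length w + 3"] exec_Seq) (assumption | simp)+
qed

section \<open>Running a given machine on the work track\<close>

definition bounded_tm :: "nat \<Rightarrow> tm \<Rightarrow> bool" where
  "bounded_tm N \<delta> \<longleftrightarrow> (\<forall>q a. fst (\<delta> q a) < N \<and> fst (snd (\<delta> q a)) < N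
     \<and> snd (snd (\<delta> q a)) \<in> {-1, 0, 1})"

lemma bounded_tm_mono: "bounded_tm N \<delta> \<Longrightarrow> N \<le> M \<Longrightarrow> bounded_tm M \<delta>"
  unfolding bounded_tm_def by (meson less_le_trans)

text \<open>Outside its state and symbol range a valid transition function is arbitrary. It may be
  reset there because runs on legal inputs never leave the range. Afterwards one number bounds every
  transition, as the well-formedness of \<open>sim\<close> requires.\<close>

lemma valid_tm_bounded:
  assumes "valid_tm \<delta>"
  shows "\<exists>\<delta>' N. 4 \<le> N \<and> bounded_tm N \<delta>' \<and>
    (\<forall>w t. set w \<subseteq> {..<4} \<longrightarrow> tm_run \<delta>' w t = tm_run \<delta> w t)"
proof -
  from assms obtain Q S where QS: "2 \<le> Q" "4 \<le> S"
    "\<And>q a. q < Q \<Longrightarrow> a < S \<Longrightarrow>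
      fst (\<delta> q a) < Q \<and> fst (snd (\<delta> q a)) < S \<and> snd (snd (\<delta> q a)) \<in> {-1, 0, 1}"
    unfolding valid_tm_def by blast
  define \<delta>' where "\<delta>' q a = (if q < Q \<and> a < S then \<delta> q a else (0, 0, 0))" for q a
  have "bounded_tm (max Q S) \<delta>'"
    unfolding bounded_tm_def \<delta>'_def using QS by (auto simp: less_max_iff_disj)
  moreover have "tm_run \<delta>' w t = tm_run \<delta> w t \<and>
      (case tm_run \<delta> w t of (q, tp, h) \<Rightarrow> q < Q \<and> (\<forall>i. tp i < S))"
    if w: "set w \<subseteq> {..<4}" for w t
  proof (induction t)
    case 0
    have "tape_of w i < S" for i
    proof (cases "0 \<le> i \<and> nat i < length w")
      case True
      then have "w ! nat i < 4" using w nth_mem[of "nat i" w] by (auto simp del: nth_mem)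
      then show ?thesis using True QS(2) by (simp add: tape_of_def)
    qed (use QS(2) in \<open>auto simp: tape_of_def\<close>)
    then show ?case using QS by (auto simp: tm_run_0)
  next
    case (Suc t)
    obtain q tp h where c: "tm_run \<delta> w t = (q, tp, h)" by (metis prod_cases3)
    then show ?case using Suc QS(3)[of q "tp h"]
      by (auto simp: tm_run_Suc tm_step_def \<delta>'_def split: prod.splits)
  qed
  moreover have "4 \<le> max Q S" using QS by simp
  ultimately show ?thesis by blast
qed

definition sim :: "tm \<Rightarrow> prog" where
  "sim \<delta> = While (\<lambda>r a. st r \<noteq> 1) (Act (\<lambda>r a. case \<delta> (st r) (wrk a) of (q, s, d) \<Rightarrow>
     (r\<lparr>st := q\<rparr>, a\<lparr>wrk := s, vis := True\<rparr>, d)))"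

text \<open>Invariant: the work track is blank outside the visited interval \<open>{l..m}\<close>,
  and the head is at most one cell outside it. Each step therefore extends the interval by at most
  one cell.\<close>

lemma exec_sim:
  assumes "bounded_tm N \<delta>" "(tm_step \<delta> ^^ t) (q, W, h) = (1, W', h')"
    and "l - 1 \<le> h" "h \<le> m + 1" "l \<le> 0" "0 \<le> m" "\<And>i. i \<notin> {l..m} \<Longrightarrow> W i = 0"
  shows "\<exists>l' m'. l - int t \<le> l' \<and> l' \<le> l \<and> m \<le> m' \<and> m' \<le> m + int t \<and>
     l' - 1 \<le> h' \<and> h' \<le> m' + 1 \<and> (\<forall>i. i \<notin> {l'..m'} \<longrightarrow> W' i = 0) \<and>
     exec (sim \<delta>) (r\<lparr>st := q\<rparr>, mk I X W {l..m}, h) (3 * t + 1)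
       (r\<lparr>st := 1\<rparr>, mk I X W' {l'..m'}, h')"
  using assms(2-)
proof (induction t arbitrary: q W h l m)
  case 0
  then show ?case unfolding sim_def
    by (intro exI[of _ l] exI[of _ m]) (simp add: exec_While_False)
next
  case (Suc t)
  show ?case
  proof (cases "q = 1")
    case True
    have "(tm_step \<delta> ^^ Suc t) (q, W, h) = (q, W, h)"
      by (rule funpow_fixpoint) (simp add: tm_step_def True)
    then have "W' = W" "h' = h" using Suc.prems(1) by auto
    moreover have "exec (sim \<delta>) (r\<lparr>st := q\<rparr>, mk I X W {l..m}, h) (3 * Suc t + 1)
       (r\<lparr>st := 1\<rparr>, mk I X W {l..m}, h)"
      unfolding sim_def using True by (simp add: exec_While_False)
    ultimately show ?thesis using Suc.prems True by (intro exI[of _ l] exI[of _ m]) auto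
  next
    case False
    obtain q1 s d where d: "\<delta> q (W h) = (q1, s, d)" by (metis prod_cases3)
    have dir: "d \<in> {-1, 0, 1}" using assms(1) d unfolding bounded_tm_def by (metis snd_conv)
    let ?W = "W(h := s)" and ?l = "min l h" and ?m = "max m h"
    \<comment> \<open>Since the head is in or next to \<open>{l..m}\<close>, adding its position
      yields an interval again.\<close>
    have set: "{?l..?m} = insert h {l..m}" using Suc.prems by auto
    have "tm_step \<delta> (q, W, h) = (q1, ?W, h + d)" using False d by (simp add: tm_step_def)
    then have "(tm_step \<delta> ^^ t) (q1, ?W, h + d) = (1, W', h')"
      using Suc.prems(1) by (simp add: funpow_Suc_right del: funpow.simps)
    then have "\<exists>l' m'. ?l - int t \<le> l' \<and> l' \<le> ?l \<and> ?m \<le> m' \<and> m' \<le> ?m + int t \<and>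
       l' - 1 \<le> h' \<and> h' \<le> m' + 1 \<and> (\<forall>i. i \<notin> {l'..m'} \<longrightarrow> W' i = 0) \<and>
       exec (sim \<delta>) (r\<lparr>st := q1\<rparr>, mk I X ?W {?l..?m}, h + d) (3 * t + 1)
         (r\<lparr>st := 1\<rparr>, mk I X W' {l'..m'}, h')"
    proof (rule Suc.IH)
      show "?W i = 0" if "i \<notin> {?l..?m}" for i using that Suc.prems(6)[of i] unfolding set by simp
    qed (use Suc.prems(2-5) dir in auto)
    then obtain l' m' where lm: "?l - int t \<le> l'" "l' \<le> ?l" "?m \<le> m'" "m' \<le> ?m + int t"
       "l' - 1 \<le> h'" "h' \<le> m' + 1" "\<forall>i. i \<notin> {l'..m'} \<longrightarrow> W' i = 0"
      and ex: "exec (sim \<delta>) (r\<lparr>st := q1\<rparr>, mk I X ?W {?l..?m}, h + d) (3 * t + 1)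
         (r\<lparr>st := 1\<rparr>, mk I X W' {l'..m'}, h')" by blast
    have "exec (sim \<delta>) (r\<lparr>st := q\<rparr>, mk I X W {l..m}, h) (1 + (3 * t + 1) + 2)
         (r\<lparr>st := 1\<rparr>, mk I X W' {l'..m'}, h')"
      unfolding sim_def
      by (rule exec_While_True[OF _ _ ex[unfolded sim_def]], use False in simp,
          rule exec_Act'[where a = "mk I X ?W {?l..?m} h" and d = d])
        (use d False in \<open>auto simp: set mk_def fun_eq_iff\<close>)
    then have "exec (sim \<delta>) (r\<lparr>st := q\<rparr>, mk I X W {l..m}, h) (3 * Suc t + 1)
         (r\<lparr>st := 1\<rparr>, mk I X W' {l'..m'}, h')" by (rule exec_mono) simp
    then show ?thesis using lm Suc.prems by (intro exI[of _ l'] exI[of _ m']) auto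
  qed
qed

text \<open>A simulated machine can halt on either side of position 0. Leaving the visited interval to the
  left and then moving right finds the origin again.\<close>

definition simulate :: "tm \<Rightarrow> prog" where
  "simulate \<delta> = Act (\<lambda>r a. (r\<lparr>st := 0\<rparr>, a, 0)) ;; sim \<delta> ;;
     Act (\<lambda>r a. (r, a\<lparr>vis := True\<rparr>, 0)) ;; sweep vis id (- 1) ;; sweep (\<lambda>a. \<not> org a) id 1"

text \<open>The work track shows \<open>out\<close> in the sense of \<open>tm_output\<close>: the
  first blank at or after the origin has position \<open>length out\<close>. Nothing is said about
  cells beyond it or to the left of the origin.\<close>

definition holds :: "(int \<Rightarrow> nat) \<Rightarrow> nat list \<Rightarrow> bool" where
  "holds W out \<longleftrightarrow> 0 \<notin> set out \<and> (\<forall>i < length out. W (int i) = out ! i) \<and> W (int (length out)) = 0"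

definition eval_on :: "tm \<Rightarrow> (cell \<Rightarrow> nat) \<Rightarrow> bool \<Rightarrow> prog" where
  "eval_on \<delta> sel suf = load sel suf ;; simulate \<delta>"

lemma exec_eval_on:
  assumes N: "bounded_tm N \<delta>" and halt: "tm_halted (tm_run \<delta> w t)"
    and u: "0 \<notin> set u" and sel: "\<And>W V i. sel (mk I X W V i) = tape_of u i"
    and w: "w = (if suf then u @ [3, sym r] else u)" and B: "length w + t \<le> B"
  shows "\<exists>W l m. l \<le> 0 \<and> 0 \<le> m \<and> - l \<le> int B + 1 \<and> m \<le> int B + 1 \<and>
     (\<forall>i. i \<notin> {l..m} \<longrightarrow> W i = 0) \<and> holds W (tm_output (tm_run \<delta> w t)) \<and>
     exec (eval_on \<delta> sel suf) (r, mk I X (\<lambda>_. 0) {}, 0) (18 * B + 50)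
      (r\<lparr>st := 1\<rparr>, mk I X W {l..m}, 0)"
proof -
  obtain W h where run: "tm_run \<delta> w t = (1, W, h)"
    using halt by (cases "tm_run \<delta> w t") (auto simp: tm_halted_def)
  have "(tm_step \<delta> ^^ t) (0, tape_of w, 0) = (1, W, h)"
    using run tm_run_0[of \<delta> w] by (simp add: tm_run_def)
  then have "\<exists>l' m'. 0 - int t \<le> l' \<and> l' \<le> 0 \<and> int (length w) \<le> m' \<and> m' \<le> int (length w) + int t \<and>
     l' - 1 \<le> h \<and> h \<le> m' + 1 \<and> (\<forall>i. i \<notin> {l'..m'} \<longrightarrow> W i = 0) \<and>
     exec (sim \<delta>) (r\<lparr>st := 0\<rparr>, mk I X (tape_of w) {0..int (length w)}, 0) (3 * t + 1)
       (r\<lparr>st := 1\<rparr>, mk I X W {l'..m'}, h)"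
    by (rule exec_sim[OF N]) (auto simp: tape_of_def)
  then obtain l' m' where lm': "0 - int t \<le> l'" "l' \<le> 0" "int (length w) \<le> m'"
      "m' \<le> int (length w) + int t" "l' - 1 \<le> h" "h \<le> m' + 1" "\<forall>i. i \<notin> {l'..m'} \<longrightarrow> W i = 0"
    and ex: "exec (sim \<delta>) (r\<lparr>st := 0\<rparr>, mk I X (tape_of w) {0..int (length w)}, 0) (3 * t + 1)
       (r\<lparr>st := 1\<rparr>, mk I X W {l'..m'}, h)" by blast
  \<comment> \<open>The machine may halt one cell outside the visited interval. Marking that cell
    lets the following sweep over \<open>vis\<close> start from there.\<close>
  define l m where "l = min l' h" and "m = max m' h"
  have lm: "l \<le> 0" "0 \<le> m" "- l \<le> int t + 1" "m \<le> int (length w) + int t + 1" "l \<le> h" "h \<le> m"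
    "\<forall>i. i \<notin> {l..m} \<longrightarrow> W i = 0" "{l..m} = insert h {l'..m'}"
    using lm' unfolding l_def m_def by (auto simp: min_le_iff_disj le_max_iff_disj)
  let ?r = "r\<lparr>st := 1\<rparr>"
  have "exec (Act (\<lambda>r a. (r\<lparr>st := 0\<rparr>, a, 0))) (r, mk I X (tape_of w) {0..int (length w)}, 0) 1
      (r\<lparr>st := 0\<rparr>, mk I X (tape_of w) {0..int (length w)}, 0)"
    by (rule exec_Act', rule refl) auto
  moreover have "exec (Act (\<lambda>r a. (r, a\<lparr>vis := True\<rparr>, 0))) (?r, mk I X W {l'..m'}, h) 1
      (?r, mk I X W {l..m}, h)"
    by (rule exec_Act', rule refl) (use lm(8) in \<open>auto simp: fun_eq_iff mk_def\<close>)
  moreover have "exec (sweep vis id (- 1)) (?r, mk I X W {l..m}, h) (3 * (2 * B + 3) + 1)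
      (?r, mk I X W {l..m}, l - 1)"
    by (rule exec_sweep_left) (use lm(1-7) B in auto)
  moreover have "exec (sweep (\<lambda>a. \<not> org a) id 1) (?r, mk I X W {l..m}, l - 1) (3 * (B + 2) + 1)
      (?r, mk I X W {l..m}, 0)"
    by (rule exec_sweep_to) (use lm(1-7) B in auto)
  ultimately have "exec (simulate \<delta>) (r, mk I X (tape_of w) {0..int (length w)}, 0) (12 * B + 30)
      (?r, mk I X W {l..m}, 0)"
    unfolding simulate_def using ex B
    by (intro exec_Seq[where ?t2.0 = "12 * B + 25"] exec_Seq[where ?t2.0 = "9 * B + 20"]
        exec_Seq[where ?t2.0 = "9 * B + 18"] exec_Seq) (assumption | simp)+
  then have "exec (eval_on \<delta> sel suf) (r, mk I X (\<lambda>_. 0) {}, 0) (18 * B + 50)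
      (?r, mk I X W {l..m}, 0)"
    unfolding eval_on_def by (rule exec_Seq[OF exec_load[OF u sel w]]) (use B in auto)
  moreover have "holds W (tm_output (tm_run \<delta> w t))"
  proof -
    let ?k = "LEAST k. W (int k) = 0"
    \<comment> \<open>The cell right of the visited interval is blank, so the \<open>LEAST\<close>
      in \<open>tm_output\<close> is attained.\<close>
    have "W (int (nat (m + 1))) = 0" using lm(2,7) by auto
    then have "W (int ?k) = 0" by (rule LeastI[where P = "\<lambda>k. W (int k) = 0"])
    moreover have "W (int i) \<noteq> 0" if "i < ?k" for i using not_less_Least[OF that] .
    ultimately show ?thesis by (force simp: holds_def run tm_output_def)
  qed
  ultimately show ?thesis using lm B by (intro exI[of _ W] exI[of _ l] exI[of _ m]) auto
qed

definition clean :: prog where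
  "clean = sweep vis id (- 1) ;; Act (\<lambda>r a. (r, a, 1)) ;;
     sweep vis (\<lambda>a. a\<lparr>wrk := 0, vis := False\<rparr>) 1 ;; home"

lemma exec_clean:
  assumes "l \<le> 0" "0 \<le> m" "- l \<le> int B + 1" "m \<le> int B + 1" "\<forall>i. i \<notin> {l..m} \<longrightarrow> W i = 0"
  shows "exec clean (r, mk I X W {l..m}, 0) (12 * B + 40) (r, mk I X (\<lambda>_. 0) {}, 0)"
proof -
  have "exec (sweep vis id (- 1)) (r, mk I X W {l..m}, 0) (3 * (B + 2) + 1) (r, mk I X W {l..m}, l - 1)"
    by (rule exec_sweep_left) (use assms in auto)
  moreover have "exec (Act (\<lambda>r a. (r, a, 1))) (r, mk I X W {l..m}, l - 1) 1 (r, mk I X W {l..m}, l)"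
    by (rule exec_Act', rule refl) auto
  moreover have "exec (sweep vis (\<lambda>a. a\<lparr>wrk := 0, vis := False\<rparr>) 1) (r, mk I X W {l..m}, l)
      (3 * (2 * B + 3) + 1) (r, mk I X (\<lambda>_. 0) {}, m + 1)"
    by (rule exec_sweep_to) (use assms in \<open>auto simp: mk_def\<close>)
  moreover have "exec home (r, mk I X (\<lambda>_. 0) {}, m + 1) (3 * (B + 2) + 1) (r, mk I X (\<lambda>_. 0) {}, 0)"
    by (rule exec_sweep_left) (use assms in auto)
  ultimately show ?thesis unfolding clean_def
    by (intro exec_Seq[where ?t2.0 = "9 * B + 22"] exec_Seq[where ?t2.0 = "9 * B + 20"]
         exec_Seq) (assumption | simp)+
qed

lemma holds_cases:
  assumes "holds W out"
  shows "\<And>j. 0 \<le> j \<Longrightarrow> j < int (length out) \<Longrightarrow> W j = tape_of out j \<and> W j \<noteq> 0"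
    and "W (int (length out)) = 0"
proof -
  fix j assume j: "0 \<le> j" "j < int (length out)"
  then have "W (int (nat j)) = out ! nat j" using assms unfolding holds_def
    by (metis nat_less_iff)
  then show "W j = tape_of out j \<and> W j \<noteq> 0"
    using j tape_of_nonzero[of out j] assms by (auto simp: holds_def tape_of_def)
qed (use assms in \<open>simp add: holds_def\<close>)

text \<open>Nonblank cells lie in the visited interval, so the length of an output is bounded in
  terms of the running time.\<close>

lemma holds_length:
  assumes "holds W out" "\<forall>i. i \<notin> {l..m} \<longrightarrow> W i = 0" "0 \<le> m" "m \<le> int B + 1"
  shows "length out \<le> B + 2"
proof (rule ccontr)
  assume "\<not> ?thesis"
  then have "m + 1 < int (length out)" using assms by simp
  then have "W (m + 1) \<noteq> 0" using holds_cases(1)[OF assms(1), of "m + 1"] assms(3) by simp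
  then show False using assms(2) by simp
qed

section \<open>Moving, printing and comparing results\<close>

definition store :: prog where
  "store = sweep (\<lambda>a. wrk a \<noteq> 0) (\<lambda>a. a\<lparr>ctr := wrk a\<rparr>) 1 ;; home"

lemma exec_store:
  assumes "holds W out"
  shows "exec store (r, mk I (\<lambda>_. 0) W V, 0) (6 * length out + 3) (r, mk I (tape_of out) W V, 0)"
proof -
  note h = holds_cases[OF assms]
  have "exec (sweep (\<lambda>a. wrk a \<noteq> 0) (\<lambda>a. a\<lparr>ctr := wrk a\<rparr>) 1) (r, mk I (\<lambda>_. 0) W V, 0)
     (3 * length out + 1) (r, mk I (tape_of out) W V, int (length out))"
  proof (rule exec_sweep_to)
    fix j
    show "wrk (mk I (\<lambda>_. 0) W V j) \<noteq> 0" if "0 \<le> j" "j < int (length out)"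
      using h(1)[of j] that by simp
    show "mk I (tape_of out) W V j = (if 0 \<le> j \<and> j < int (length out)
      then (mk I (\<lambda>_. 0) W V j)\<lparr>ctr := wrk (mk I (\<lambda>_. 0) W V j)\<rparr> else mk I (\<lambda>_. 0) W V j)"
      using h(1)[of j] by (auto simp: mk_def tape_of_def)
  qed (use h(2) in auto)
  moreover have "exec home (r, mk I (tape_of out) W V, int (length out)) (3 * length out + 1)
      (r, mk I (tape_of out) W V, 0)"
    by (rule exec_sweep_left) auto
  ultimately show ?thesis unfolding store_def by (rule exec_Seq) simp
qed

text \<open>Output cells become plain, and so does the first cell behind them, since the compiled
  machine's output ends only at a cell that is blank on every track and unmarked.\<close>

definition emit :: prog where
  "emit = sweep (\<lambda>a. wrk a \<noteq> 0) (\<lambda>a. plain (wrk a)) 1 ;; Act (\<lambda>r a. (r, plain 0, 0))"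

lemma exec_emit:
  assumes "holds W out"
  shows "\<exists>tp h. exec emit (r, mk I X W V, 0) (3 * length out + 3) (r, tp, h) \<and>
    (\<forall>i<length out. tp (int i) = plain (out ! i)) \<and> tp (int (length out)) = plain 0"
proof -
  let ?n = "int (length out)"
  let ?tp = "\<lambda>j. if 0 \<le> j \<and> j < ?n then plain (wrk (mk I X W V j)) else mk I X W V j"
  note h = holds_cases[OF assms]
  have "exec (sweep (\<lambda>a. wrk a \<noteq> 0) (\<lambda>a. plain (wrk a)) 1) (r, mk I X W V, 0)
     (3 * length out + 1) (r, ?tp, ?n)"
  proof (rule exec_sweep_to)
    show "wrk (mk I X W V j) \<noteq> 0" if "0 \<le> j" "j < ?n" for j
      using h(1)[of j] that by simp
  qed (use h(2) in auto)
  moreover have "exec (Act (\<lambda>r a. (r, plain 0, 0))) (r, ?tp, ?n) 1 (r, ?tp(?n := plain 0), ?n)"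
    by (rule exec_Act', rule refl) auto
  ultimately have "exec emit (r, mk I X W V, 0) (3 * length out + 3) (r, ?tp(?n := plain 0), ?n)"
    unfolding emit_def by (rule exec_Seq) simp
  then show ?thesis using assms
    by (intro exI[of _ "?tp(?n := plain 0)"] exI[of _ ?n]) (auto simp: holds_def)
qed

definition compare :: prog where
  "compare = sweep (\<lambda>a. wrk a = inp a \<and> wrk a \<noteq> 0) id 1 ;;
     Act (\<lambda>r a. (r\<lparr>flag := if wrk a = 0 \<and> inp a = 0 then 1 else 0\<rparr>, a, 0)) ;; home"

text \<open>The sweep stops at the first position where the tracks differ or the work track is
  blank. Both words are free of blanks, so they coincide exactly if both tracks are blank
  there.\<close>

lemma exec_compare:
  assumes hold: "holds W out" and z: "0 \<notin> set z"
  shows "exec compare (r, mk (tape_of z) X W V, 0) (6 * length out + 6)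
    (r\<lparr>flag := if out = z then 1 else 0\<rparr>, mk (tape_of z) X W V, 0)"
proof -
  note h = holds_cases[OF hold]
  let ?b = "\<lambda>j. W (int j) = tape_of z (int j) \<and> W (int j) \<noteq> 0"
  define k where "k = (LEAST j. \<not> ?b j)"
  have nk: "\<not> ?b k" unfolding k_def by (rule LeastI[of _ "length out"]) (use h in simp)
  have lk: "?b j" if "j < k" for j using not_less_Least[of j "\<lambda>j. \<not> ?b j"] that k_def by auto
  have kl: "k \<le> length out" unfolding k_def by (rule Least_le) (use h in simp)
  let ?f = "if W (int k) = 0 \<and> tape_of z (int k) = 0 then 1 else 0 :: nat"
  have "exec (sweep (\<lambda>a. wrk a = inp a \<and> wrk a \<noteq> 0) id 1) (r, mk (tape_of z) X W V, 0)
      (3 * length out + 1) (r, mk (tape_of z) X W V, int k)"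
  proof (rule exec_sweep_to)
    fix j :: int assume "0 \<le> j" "j < int k"
    then show "wrk (mk (tape_of z) X W V j) = inp (mk (tape_of z) X W V j)
        \<and> wrk (mk (tape_of z) X W V j) \<noteq> 0"
      using lk[of "nat j"] \<open>0 \<le> j\<close> \<open>j < int k\<close> by (simp add: nat_less_iff)
  qed (use nk kl in auto)
  moreover have "exec (Act (\<lambda>r a. (r\<lparr>flag := if wrk a = 0 \<and> inp a = 0 then 1 else 0\<rparr>, a, 0)))
      (r, mk (tape_of z) X W V, int k) 1 (r\<lparr>flag := ?f\<rparr>, mk (tape_of z) X W V, int k)"
    by (rule exec_Act', rule refl) auto
  moreover have "exec home (r\<lparr>flag := ?f\<rparr>, mk (tape_of z) X W V, int k) (3 * length out + 1)
      (r\<lparr>flag := ?f\<rparr>, mk (tape_of z) X W V, 0)"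
    by (rule exec_sweep_left) (use kl in auto)
  ultimately have "exec compare (r, mk (tape_of z) X W V, 0) (6 * length out + 6)
      (r\<lparr>flag := ?f\<rparr>, mk (tape_of z) X W V, 0)"
    unfolding compare_def by (intro exec_Seq[where ?t2.0 = "3 * length out + 3"] exec_Seq) (assumption | simp)+
  moreover have "(W (int k) = 0 \<and> tape_of z (int k) = 0) \<longleftrightarrow> out = z"
  proof
    assume *: "W (int k) = 0 \<and> tape_of z (int k) = 0"
    then have ko: "k = length out" using h(1)[of "int k"] kl by fastforce
    have "\<not> k < length z" using * z tape_of_nonzero[of z "int k"] by auto
    moreover have "\<not> length z < k" using lk[of "length z"] tape_of_end[of z "int (length z)"] by auto
    ultimately have kz: "k = length z" by simp
    show "out = z"
    proof (rule nth_equalityI)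
      fix i assume "i < length out"
      then show "out ! i = z ! i" using lk[of i] hold ko kz by (auto simp: holds_def tape_of_def)
    qed (use ko kz in simp)
  next
    assume *: "out = z"
    have "\<not> k < length out" using nk h(1)[of "int k"] * by auto
    then have "k = length z" using kl * by simp
    then show "W (int k) = 0 \<and> tape_of z (int k) = 0"
      using h(2) tape_of_end[of z "int k"] * by simp
  qed
  ultimately show ?thesis by simp
qed

section \<open>Searching for a preimage\<close>

text \<open>Bijective binary numeration with the least significant digit first. It enumerates all strings by
  increasing length, but not in the order of \<^const>\<open>str\<close>; only the lengths matter for the search,
  and carries propagate away from the origin.\<close>

fun inc :: "bool list \<Rightarrow> bool list" where
  "inc [] = [False]"
| "inc (True # x) = False # inc x"
| "inc (False # x) = True # x"

fun bnum :: "bool list \<Rightarrow> nat" where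
  "bnum [] = 0"
| "bnum (b # x) = (if b then 2 else 1) + 2 * bnum x"

lemma bnum_inc: "bnum (inc x) = bnum x + 1"
  by (induction x rule: inc.induct) auto

lemma bnum_inject: "bnum x = bnum y \<Longrightarrow> x = y"
proof (induction x arbitrary: y)
  case Nil
  then show ?case by (cases y) (auto split: if_splits)
next
  case (Cons a x)
  show ?case
  proof (cases y)
    case Nil
    then show ?thesis using Cons.prems by (auto split: if_splits)
  next
    case (Cons b y')
    have e: "(if a then 2 else 1) + 2 * bnum x = (if b then 2 else 1) + 2 * bnum y'"
      using Cons.prems Cons by simp
    have "a = b" using arg_cong[OF e, of even] by (auto split: if_splits)
    then show ?thesis using e Cons.IH[of y'] Cons by simp
  qed
qed

lemma bnum_upper: "bnum x + 1 < 2 ^ (length x + 1)"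
  by (induction x) auto

lemma bnum_lower: "2 ^ length x \<le> bnum x + 1"
  by (induction x) auto

lemma bnum_length_less: "length x < length y \<Longrightarrow> bnum x < bnum y"
proof -
  assume "length x < length y"
  then have "(2::nat) ^ (length x + 1) \<le> 2 ^ length y" by (intro power_increasing) auto
  then show ?thesis using bnum_upper[of x] bnum_lower[of y] by linarith
qed

text \<open>A carry runs through the leading ones and ends either behind the string or at the first
  zero. These are the two ways in which the sweep of \<open>increment\<close> can stop.\<close>

lemma inc_cases:
  obtains k where "x = replicate k True" "inc x = replicate k False @ [False]"
  | k ys where "x = replicate k True @ False # ys" "inc x = replicate k False @ True # ys"
proof (induction x arbitrary: thesis rule: inc.induct)
  case 1
  show ?case by (rule 1(1)[of 0]) auto
next
  case (2 x)
  show ?case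
  proof (rule 2(1))
    fix k assume "x = replicate k True" "inc x = replicate k False @ [False]"
    then show ?thesis by (intro 2(2)[of "Suc k"]) auto
  next
    fix k ys assume "x = replicate k True @ False # ys" "inc x = replicate k False @ True # ys"
    then show ?thesis by (intro 2(3)[of "Suc k" ys]) auto
  qed
next
  case (3 x)
  show ?case by (rule 3(2)[of 0 x]) auto
qed

lemma length_enc_str [simp]: "length (enc_str x) = length x"
  by (simp add: enc_str_def)

lemma enc_str_symbols: "a \<in> set (enc_str x) \<Longrightarrow> a = 1 \<or> a = 2"
  by (auto simp: enc_str_def enc_bit_def split: if_splits)

lemma enc_str_inject: "enc_str x = enc_str y \<longleftrightarrow> x = y"
  unfolding enc_str_def by (rule inj_map_eq_map) (auto simp: inj_def enc_bit_def)

text \<open>The flag becomes 2 when the counter would grow longer than the input.\<close>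

definition increment :: prog where
  "increment = sweep (\<lambda>a. ctr a = 2) (\<lambda>a. a\<lparr>ctr := 1\<rparr>) 1 ;;
     Act (\<lambda>r a. if ctr a = 1 then (r, a\<lparr>ctr := 2\<rparr>, 0)
       else if inp a \<noteq> 0 then (r, a\<lparr>ctr := 1\<rparr>, 0) else (r\<lparr>flag := 2\<rparr>, a, 0)) ;; home"

lemma exec_increment:
  assumes "length x \<le> length z"
  shows "\<exists>X. exec increment (r, mk (tape_of (enc_str z)) (tape_of (enc_str x)) W V, 0) (6 * length z + 5)
      (if length (inc x) \<le> length z then r else r\<lparr>flag := 2\<rparr>, mk (tape_of (enc_str z)) X W V, 0) \<and>
    (length (inc x) \<le> length z \<longrightarrow> X = tape_of (enc_str (inc x)))"
proof -
  let ?M = "\<lambda>X. mk (tape_of (enc_str z)) X W V"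
  let ?t = "\<lambda>x. tape_of (enc_str x)"
  \<comment> \<open>Both carry cases run alike: \<open>k\<close> is the length of the block passed
    by the carry, \<open>X\<close> the counter after clearing that block, and \<open>a\<close> the
    symbol left in cell \<open>k\<close>.\<close>
  have run: "exec increment (r, ?M (?t x), 0) (6 * length z + 5) (r', ?M X', 0)"
    if k: "k \<le> length z" "\<And>j. 0 \<le> j \<Longrightarrow> j < int k \<Longrightarrow> ?t x j = 2" "?t x (int k) \<noteq> 2"
      and X: "\<And>j. X j = (if 0 \<le> j \<and> j < int k then 1 else ?t x j)" "\<And>j. X' j = (if j = int k then a else X j)"
      and a: "(if ?t x (int k) = 1 then r' = r \<and> a = 2 else if ?t z (int k) \<noteq> 0 then r' = r \<and> a = 1
        else r' = r\<lparr>flag := 2\<rparr> \<and> a = ?t x (int k))"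
    for k r' X X' a
  proof -
    have "exec (sweep (\<lambda>a. ctr a = 2) (\<lambda>a. a\<lparr>ctr := 1\<rparr>) 1) (r, ?M (?t x), 0) (3 * length z + 1)
        (r, ?M X, int k)"
      by (rule exec_sweep_to) (use k X in \<open>auto simp: mk_def\<close>)
    moreover have "exec (Act (\<lambda>r a. if ctr a = 1 then (r, a\<lparr>ctr := 2\<rparr>, 0)
         else if inp a \<noteq> 0 then (r, a\<lparr>ctr := 1\<rparr>, 0) else (r\<lparr>flag := 2\<rparr>, a, 0)))
        (r, ?M X, int k) 1 (r', ?M X', int k)"
      by (rule exec_Act'[where a = "?M X' (int k)" and d = 0])
        (use a X in \<open>auto simp: mk_def fun_eq_iff split: if_splits\<close>)
    moreover have "exec home (r', ?M X', int k) (3 * length z + 1) (r', ?M X', 0)"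
      by (rule exec_sweep_left) (use k in auto)
    ultimately show ?thesis unfolding increment_def
      by (intro exec_Seq[where ?t2.0 = "3 * length z + 3"] exec_Seq) (assumption | simp)+
  qed
  show ?thesis
  proof (cases x rule: inc_cases)
    case (1 k)
    have tx: "?t x j = (if 0 \<le> j \<and> j < int k then 2 else 0)" for j
      using 1(1) by (auto simp: tape_of_def enc_str_def enc_bit_def)
    have ti: "?t (inc x) j = (if 0 \<le> j \<and> j \<le> int k then 1 else 0)" for j
      using 1(2) by (auto simp: tape_of_def enc_str_def enc_bit_def nth_append)
    \<comment> \<open>The input track serves as a ruler: a nonblank cell \<open>k\<close> means that
      a counter of length \<open>k + 1\<close> still fits.\<close>
    have tz: "?t z (int k) \<noteq> 0 \<longleftrightarrow> k < length z"
      by (auto simp: tape_of_def enc_str_def enc_bit_def)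
    show ?thesis
    proof (cases "k < length z")
      case True
      have "exec increment (r, ?M (?t x), 0) (6 * length z + 5) (r, ?M (?t (inc x)), 0)"
        by (rule run[where k = k and a = 1 and X = "\<lambda>j. if 0 \<le> j \<and> j < int k then 1 else ?t x j"])
          (use True tz in \<open>auto simp: tx ti\<close>)
      then show ?thesis using True 1(2) by (intro exI[of _ "?t (inc x)"]) auto
    next
      case False
      moreover have "k \<le> length z" using assms 1(1) by simp
      ultimately have "exec increment (r, ?M (?t x), 0) (6 * length z + 5)
          (r\<lparr>flag := 2\<rparr>, ?M (\<lambda>j. if 0 \<le> j \<and> j < int k then 1 else ?t x j), 0)"
        by (intro run[where k = k and a = 0 and X = "\<lambda>j. if 0 \<le> j \<and> j < int k then 1 else ?t x j"])
          (use tz in \<open>auto simp: tx\<close>)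
      then show ?thesis using False 1(2)
        by (intro exI[of _ "\<lambda>j. if 0 \<le> j \<and> j < int k then 1 else ?t x j"]) auto
    qed
  next
    case (2 k ys)
    have tx: "?t x j = 2" if "0 \<le> j" "j < int k" for j
      using 2(1) that by (auto simp: tape_of_def enc_str_def enc_bit_def nth_append)
    have txk: "?t x (int k) = 1"
      using 2(1) by (auto simp: tape_of_def enc_str_def enc_bit_def nth_append)
    have ti: "?t (inc x) j = (if j = int k then 2 else if 0 \<le> j \<and> j < int k then 1 else ?t x j)" for j
    proof (cases j)
      case (nonneg i)
      show ?thesis unfolding 2(2) unfolding 2(1) nonneg
        by (auto simp: tape_of_def enc_str_def enc_bit_def nth_append nth_Cons split: nat.splits)
    qed (auto simp: tape_of_def)
    have "exec increment (r, ?M (?t x), 0) (6 * length z + 5) (r, ?M (?t (inc x)), 0)"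
      by (rule run[where k = k and a = 2 and X = "\<lambda>j. if 0 \<le> j \<and> j < int k then 1 else ?t x j"])
        (use assms 2(1) tx txk ti in auto)
    moreover have "length (inc x) = length x" using 2 by simp
    ultimately show ?thesis using assms by (intro exI[of _ "?t (inc x)"]) auto
  qed
qed

definition search_body :: "tm \<Rightarrow> prog" where
  "search_body \<delta> = eval_on \<delta> ctr False ;; compare ;; clean ;; Cond (\<lambda>r a. flag r = 1) Skip increment"

definition search :: "tm \<Rightarrow> prog" where
  "search \<delta> = While (\<lambda>r a. flag r = 0) (search_body \<delta>)"

lemma exec_search_body:
  assumes N: "bounded_tm N \<delta>" and t: "t \<le> T" "tm_halted (tm_run \<delta> (enc_str x) t)"
    "tm_output (tm_run \<delta> (enc_str x) t) = enc_str y" and x: "length x \<le> length z"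
    and r: "flag r = 0"
  shows "\<exists>X r'. sym r' = sym r \<and>
    exec (search_body \<delta>) (r, mk (tape_of (enc_str z)) (tape_of (enc_str x)) (\<lambda>_. 0) {}, 0)
      (42 * (length z + T) + 150) (r', mk (tape_of (enc_str z)) X (\<lambda>_. 0) {}, 0) \<and>
    (if y = z then flag r' = 1 \<and> X = tape_of (enc_str x)
     else if length (inc x) \<le> length z then flag r' = 0 \<and> X = tape_of (enc_str (inc x))
     else flag r' = 2)"
proof -
  let ?B = "length z + T" and ?I = "tape_of (enc_str z)" and ?X = "tape_of (enc_str x)"
  let ?r1 = "r\<lparr>st := 1\<rparr>"
  let ?r2 = "?r1\<lparr>flag := if enc_str y = enc_str z then 1 else 0\<rparr>"
  have nz: "0 \<notin> set (enc_str u)" for u using enc_str_symbols[of 0 u] by auto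
  obtain W l m where lm: "l \<le> 0" "0 \<le> m" "- l \<le> int ?B + 1" "m \<le> int ?B + 1"
      "\<forall>i. i \<notin> {l..m} \<longrightarrow> W i = 0" and hold: "holds W (enc_str y)"
    and e1: "exec (eval_on \<delta> ctr False) (r, mk ?I ?X (\<lambda>_. 0) {}, 0) (18 * ?B + 50)
      (?r1, mk ?I ?X W {l..m}, 0)"
    using exec_eval_on[OF N t(2) nz, of ctr ?I ?X x False r ?B] t x by auto
  have len: "length (enc_str y) \<le> ?B + 2" by (rule holds_length[OF hold lm(5,2,4)])
  note e2 = exec_compare[OF hold nz, of ?r1 z ?X "{l..m}"]
  note e3 = exec_clean[OF lm, of ?r2 ?I ?X]
  obtain X r' where e4: "exec (Cond (\<lambda>r a. flag r = 1) Skip increment) (?r2, mk ?I ?X (\<lambda>_. 0) {}, 0)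
      (6 * length z + 6) (r', mk ?I X (\<lambda>_. 0) {}, 0)" and "sym r' = sym r"
    "if y = z then flag r' = 1 \<and> X = ?X
     else if length (inc x) \<le> length z then flag r' = 0 \<and> X = tape_of (enc_str (inc x))
     else flag r' = 2"
  proof (cases "y = z")
    case True
    have "exec (Cond (\<lambda>r a. flag r = 1) Skip increment) (?r2, mk ?I ?X (\<lambda>_. 0) {}, 0)
        (6 * length z + 5 + 1) (?r2, mk ?I ?X (\<lambda>_. 0) {}, 0)"
      by (rule exec_Cond) (use True in simp)
    then have "exec (Cond (\<lambda>r a. flag r = 1) Skip increment) (?r2, mk ?I ?X (\<lambda>_. 0) {}, 0)
        (6 * length z + 6) (?r2, mk ?I ?X (\<lambda>_. 0) {}, 0)" by (rule exec_mono) simp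
    then show ?thesis by (rule that) (use True in auto)
  next
    case False
    obtain X where X: "exec increment (?r2, mk ?I ?X (\<lambda>_. 0) {}, 0) (6 * length z + 5)
      (if length (inc x) \<le> length z then ?r2 else ?r2\<lparr>flag := 2\<rparr>, mk ?I X (\<lambda>_. 0) {}, 0)"
      "length (inc x) \<le> length z \<longrightarrow> X = tape_of (enc_str (inc x))"
      using exec_increment[OF x] by blast
    have "exec (Cond (\<lambda>r a. flag r = 1) Skip increment) (?r2, mk ?I ?X (\<lambda>_. 0) {}, 0)
        (6 * length z + 5 + 1)
        (if length (inc x) \<le> length z then ?r2 else ?r2\<lparr>flag := 2\<rparr>, mk ?I X (\<lambda>_. 0) {}, 0)"
      by (rule exec_Cond) (use False X(1) in \<open>simp add: enc_str_inject\<close>)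
    then have "exec (Cond (\<lambda>r a. flag r = 1) Skip increment) (?r2, mk ?I ?X (\<lambda>_. 0) {}, 0)
        (6 * length z + 6)
        (if length (inc x) \<le> length z then ?r2 else ?r2\<lparr>flag := 2\<rparr>, mk ?I X (\<lambda>_. 0) {}, 0)"
      by (rule exec_mono) simp
    then show ?thesis by (rule that) (use False X(2) in \<open>auto simp: enc_str_inject\<close>)
  qed
  \<comment> \<open>The coefficient 42 is 18 for the evaluation, 6 for the comparison, 12 for
    cleaning and 6 for the increment.\<close>
  moreover have "exec (search_body \<delta>) (r, mk ?I ?X (\<lambda>_. 0) {}, 0) (42 * ?B + 150)
      (r', mk ?I X (\<lambda>_. 0) {}, 0)"
    unfolding search_body_def
    by (rule exec_mono[OF exec_Seq[OF e1 exec_Seq[OF e2 exec_Seq[OF e3 e4 order_refl] order_refl] order_refl]])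
      (use len in simp)
  ultimately show ?thesis by blast
qed

text \<open>Strings no longer than \<open>z\<close> have numbers below
  \<open>2 ^ (length z + 1)\<close>. Each candidate is charged \<open>C\<close>, which is the body
  plus two steps of loop overhead; the final failing test is the extra 1. The failure clause
  concerns numbers from \<open>bnum x\<close> on, so a start at the empty string excludes every
  candidate.\<close>

lemma exec_search:
  fixes z T
  defines "C \<equiv> 42 * (length z + T) + 152"
  assumes N: "bounded_tm N \<delta>" and run: "\<And>x. length x \<le> length z \<Longrightarrow> \<exists>t\<le>T.
      tm_halted (tm_run \<delta> (enc_str x) t) \<and> tm_output (tm_run \<delta> (enc_str x) t) = enc_str (f x)"
    and "length x \<le> length z" "flag r = 0"
  shows "\<exists>X r'. sym r' = sym r \<and>
    exec (search \<delta>) (r, mk (tape_of (enc_str z)) (tape_of (enc_str x)) (\<lambda>_. 0) {}, 0)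
      (C * (2 ^ (length z + 1) - bnum x) + 1) (r', mk (tape_of (enc_str z)) X (\<lambda>_. 0) {}, 0) \<and>
    ((\<exists>y. f y = z \<and> length y \<le> length z \<and> flag r' = 1 \<and> X = tape_of (enc_str y)) \<or>
     (flag r' = 2 \<and> (\<forall>y. length y \<le> length z \<longrightarrow> bnum x \<le> bnum y \<longrightarrow> f y \<noteq> z)))"
  using assms(4-)
proof (induction "2 ^ (length z + 1) - bnum x" arbitrary: x r rule: less_induct)
  case less
  let ?I = "tape_of (enc_str z)"
  let ?S = "\<lambda>x r. (r, mk ?I (tape_of (enc_str x)) (\<lambda>_. 0) {}, 0)"
  have meas: "bnum x + 1 < 2 ^ (length z + 1)"
  proof -
    have "(2::nat) ^ (length x + 1) \<le> 2 ^ (length z + 1)"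
      using less.prems(1) by (intro power_increasing) auto
    then show ?thesis using bnum_upper[of x] by linarith
  qed
  then have C: "C * (2 ^ (length z + 1) - bnum x) = C + C * (2 ^ (length z + 1) - (bnum x + 1))"
    by (metis Suc_diff_Suc Suc_eq_plus1 add_lessD1 mult_Suc_right)
  obtain t where t: "t \<le> T" "tm_halted (tm_run \<delta> (enc_str x) t)"
    "tm_output (tm_run \<delta> (enc_str x) t) = enc_str (f x)" using run less.prems(1) by blast
  obtain X r' where r': "sym r' = sym r"
    and e: "exec (search_body \<delta>) (?S x r) (42 * (length z + T) + 150) (r', mk ?I X (\<lambda>_. 0) {}, 0)"
    and c: "if f x = z then flag r' = 1 \<and> X = tape_of (enc_str x)
     else if length (inc x) \<le> length z then flag r' = 0 \<and> X = tape_of (enc_str (inc x))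
     else flag r' = 2"
    using exec_search_body[OF N t less.prems] by blast
  have loop: "exec (search \<delta>) (?S x r) (42 * (length z + T) + 150 + t2 + 2) s"
    if "exec (search \<delta>) (r', mk ?I X (\<lambda>_. 0) {}, 0) t2 s" for t2 s
    using that unfolding search_def by (intro exec_While_True[OF _ e]) (simp_all add: less.prems(2))
  have stop: "exec (search \<delta>) (?S x r) (C * (2 ^ (length z + 1) - bnum x) + 1)
      (r', mk ?I X (\<lambda>_. 0) {}, 0)" if "flag r' \<noteq> 0"
  proof (rule exec_mono)
    show "exec (search \<delta>) (?S x r) (42 * (length z + T) + 150 + 1 + 2) (r', mk ?I X (\<lambda>_. 0) {}, 0)"
      by (rule loop, unfold search_def, rule exec_While_False) (simp_all add: that)
  qed (unfold C, simp add: C_def)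
  consider "f x = z" | "f x \<noteq> z" "length (inc x) \<le> length z" | "f x \<noteq> z" "length z < length (inc x)"
    by linarith
  then show ?case
  proof cases
    case 1
    then show ?thesis using c stop r' less.prems(1)
      by (intro exI[of _ X] exI[of _ r']) auto
  next
    case 2
    have "2 ^ (length z + 1) - bnum (inc x) < 2 ^ (length z + 1) - bnum x"
      using meas by (simp add: bnum_inc)
    moreover have fl: "flag r' = 0" "X = tape_of (enc_str (inc x))" using c 2 by auto
    ultimately obtain X' r'' where IH: "sym r'' = sym r'"
      "exec (search \<delta>) (?S (inc x) r')
        (C * (2 ^ (length z + 1) - bnum (inc x)) + 1) (r'', mk ?I X' (\<lambda>_. 0) {}, 0)"
      "(\<exists>y. f y = z \<and> length y \<le> length z \<and> flag r'' = 1 \<and> X' = tape_of (enc_str y)) \<or>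
       (flag r'' = 2 \<and> (\<forall>y. length y \<le> length z \<longrightarrow> bnum (inc x) \<le> bnum y \<longrightarrow> f y \<noteq> z))"
      using less.hyps[of "inc x" r'] 2(2) by blast
    have "exec (search \<delta>) (?S x r) (C * (2 ^ (length z + 1) - bnum x) + 1)
        (r'', mk ?I X' (\<lambda>_. 0) {}, 0)"
      by (rule exec_mono[OF loop[of _ "(r'', mk ?I X' (\<lambda>_. 0) {}, 0)"]], rule IH(2)[folded fl(2)])
        (unfold C, simp add: bnum_inc C_def)
    moreover have "f y \<noteq> z" if "bnum (inc x) \<le> bnum y \<Longrightarrow> f y \<noteq> z" "bnum x \<le> bnum y" for y
    proof (cases "bnum x = bnum y")
      case True
      then show ?thesis using 2(1) bnum_inject by blast
    qed (use that bnum_inc[of x] in simp)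
    ultimately show ?thesis using IH(1,3) r'
      by (intro exI[of _ X'] exI[of _ r'']) (metis (no_types))
  next
    case 3
    have fl: "flag r' = 2" using c 3 by auto
    have "f y \<noteq> z" if "length y \<le> length z" "bnum x \<le> bnum y" for y
    proof -
      \<comment> \<open>The successor of \<open>x\<close> is longer than \<open>z\<close>, hence has
        a larger number than every candidate; only \<open>x\<close> itself remains.\<close>
      have "bnum y < bnum x + 1" using bnum_length_less[of y "inc x"] that 3 by (simp add: bnum_inc)
      then show ?thesis using that 3(1) bnum_inject[of x y] by auto
    qed
    then show ?thesis using stop fl r' by (intro exI[of _ X] exI[of _ r']) auto
  qed
qed

section \<open>Polynomial-time predictors\<close>

definition regs :: "nat \<Rightarrow> reg set" where
  "regs N = {r. st r < N \<and> sym r < N \<and> flag r < N}"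

definition cells :: "nat \<Rightarrow> cell set" where
  "cells N = {a. inp a < N \<and> ctr a < N \<and> wrk a < N}"

lemma finite_regs: "finite (regs N)"
proof -
  have "regs N \<subseteq> (\<lambda>(s, b, f). \<lparr>st = s, sym = b, flag = f\<rparr>) ` ({..<N} \<times> {..<N} \<times> {..<N})"
  proof
    fix r :: reg assume "r \<in> regs N"
    then show "r \<in> (\<lambda>(s, b, f). \<lparr>st = s, sym = b, flag = f\<rparr>) ` ({..<N} \<times> {..<N} \<times> {..<N})"
      by (intro image_eqI[of _ _ "(st r, sym r, flag r)"]) (auto simp: regs_def)
  qed
  then show ?thesis by (rule finite_subset) simp
qed

lemma finite_cells: "finite (cells N)"
proof -
  let ?f = "\<lambda>(i, x, w, u, v). \<lparr>inp = i, ctr = x, wrk = w, org = u, vis = v\<rparr>"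
  let ?D = "{..<N} \<times> {..<N} \<times> {..<N} \<times> (UNIV :: bool set) \<times> (UNIV :: bool set)"
  have "cells N \<subseteq> ?f ` ?D"
  proof
    fix a :: cell assume "a \<in> cells N"
    then show "a \<in> ?f ` ?D"
      by (intro image_eqI[of _ _ "(inp a, ctr a, wrk a, org a, vis a)"]) (auto simp: cells_def)
  qed
  then show ?thesis by (rule finite_subset) simp
qed

lemma regs_iff: "r \<in> regs N \<longleftrightarrow> st r < N \<and> sym r < N \<and> flag r < N"
  by (simp add: regs_def)

lemma cells_iff: "a \<in> cells N \<longleftrightarrow> inp a < N \<and> ctr a < N \<and> wrk a < N"
  by (simp add: cells_def)

lemma wf_sweep:
  "(\<And>a. a \<in> A \<Longrightarrow> F a \<in> A) \<Longrightarrow> d = 1 \<or> d = - 1 \<Longrightarrow> wf_cmd R A (sweep b F d)"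
  by (auto simp: sweep_def)

context
  fixes N :: nat
  assumes N: "4 \<le> N"
begin

lemma wf_read_input: "wf_cmd (regs N) (cells N) read_input"
  using N unfolding read_input_def by (auto intro!: wf_sweep simp: regs_iff cells_iff)

lemma wf_eval_on:
  assumes "bounded_tm N \<delta>" "\<And>a. a \<in> cells N \<Longrightarrow> sel a < N"
  shows "wf_cmd (regs N) (cells N) (eval_on \<delta> sel suf)"
proof -
  have "wf_cmd (regs N) (cells N) (sim \<delta>)"
    unfolding sim_def wf_cmd.simps
  proof (intro ballI)
    fix r a assume "r \<in> regs N" "a \<in> cells N"
    moreover obtain q s d where "\<delta> (st r) (wrk a) = (q, s, d)" by (metis prod_cases3)
    moreover have "fst (\<delta> (st r) (wrk a)) < N" "fst (snd (\<delta> (st r) (wrk a))) < N"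
      "snd (snd (\<delta> (st r) (wrk a))) \<in> {-1, 0, 1}"
      using assms(1) unfolding bounded_tm_def by blast+
    ultimately show "(case \<delta> (st r) (wrk a) of (q, s, d) \<Rightarrow> (r\<lparr>st := q\<rparr>, a\<lparr>wrk := s, vis := True\<rparr>, d))
        \<in> regs N \<times> cells N \<times> {-1, 0, 1}"
      by (auto simp: regs_iff cells_iff)
  qed
  moreover have "wf_cmd (regs N) (cells N) (load sel suf)"
    using N assms(2) unfolding load_def by (auto intro!: wf_sweep simp: regs_iff cells_iff)
  ultimately show ?thesis
    using N unfolding eval_on_def simulate_def
    by (auto intro!: wf_sweep simp: regs_iff cells_iff)
qed

lemma wf_clean: "wf_cmd (regs N) (cells N) clean"
  using N unfolding clean_def by (auto intro!: wf_sweep simp: regs_iff cells_iff)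

lemma wf_store: "wf_cmd (regs N) (cells N) store"
  using N unfolding store_def by (auto intro!: wf_sweep simp: regs_iff cells_iff)

lemma wf_emit: "wf_cmd (regs N) (cells N) emit"
  using N unfolding emit_def by (auto intro!: wf_sweep simp: regs_iff cells_iff plain_def)

lemma wf_search: "bounded_tm N \<delta> \<Longrightarrow> wf_cmd (regs N) (cells N) (search \<delta>)"
  using N unfolding search_def search_body_def compare_def increment_def
  by (auto intro!: wf_sweep wf_eval_on wf_clean simp: regs_iff cells_iff)

end

section \<open>Polynomial growth in the index\<close>

definition polybd :: "(nat \<Rightarrow> nat) \<Rightarrow> bool" where
  "polybd g \<longleftrightarrow> (\<exists>k. \<forall>n. g n \<le> (n + 2) ^ k)"

lemma polybd_mono: "polybd g \<Longrightarrow> (\<And>n. f n \<le> g n) \<Longrightarrow> polybd f"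
  unfolding polybd_def by (meson order_trans)

lemma polybd_const: "polybd (\<lambda>n. c)"
  unfolding polybd_def
proof (intro exI[of _ c] allI)
  fix n :: nat
  have "c \<le> 2 ^ c" by (simp add: less_imp_le)
  also have "\<dots> \<le> (n + 2) ^ c" by (rule power_mono) auto
  finally show "c \<le> (n + 2) ^ c" .
qed

lemma polybd_id: "polybd (\<lambda>n. n)"
  unfolding polybd_def by (rule exI[of _ 1]) simp

lemma polybd_mult:
  assumes "polybd f" "polybd g"
  shows "polybd (\<lambda>n. f n * g n)"
proof -
  obtain k l where "\<forall>n. f n \<le> (n + 2) ^ k" "\<forall>n. g n \<le> (n + 2) ^ l"
    using assms unfolding polybd_def by blast
  then have "f n * g n \<le> (n + 2) ^ (k + l)" for n
    unfolding power_add by (simp add: mult_le_mono)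
  then show ?thesis unfolding polybd_def by blast
qed

lemma polybd_add:
  assumes "polybd f" "polybd g"
  shows "polybd (\<lambda>n. f n + g n)"
proof -
  \<comment> \<open>Sums reduce to products, as
    \<open>f n + g n \<le> (f n + 1) * (g n + 1)\<close>.\<close>
  have "polybd (\<lambda>n. (f n + 1) * (g n + 1))"
  proof (rule polybd_mult)
    have *: "polybd (\<lambda>n. h n + 1)" if h: "polybd h" for h
    proof -
      obtain k where k: "\<forall>n. h n \<le> (n + 2) ^ k" using h unfolding polybd_def by blast
      have "h n + 1 \<le> (n + 2) ^ (k + 1)" for n
      proof -
        have "1 \<le> (n + 2) ^ k" by simp
        then have "h n + 1 \<le> 2 * (n + 2) ^ k" using k[rule_format, of n] by linarith
        also have "\<dots> \<le> (n + 2) ^ (k + 1)" by simp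
        finally show ?thesis .
      qed
      then show ?thesis unfolding polybd_def by blast
    qed
    show "polybd (\<lambda>n. f n + 1)" "polybd (\<lambda>n. g n + 1)" using assms * by blast+
  qed
  then show ?thesis by (rule polybd_mono) simp
qed

lemma polybd_power: "polybd f \<Longrightarrow> polybd (\<lambda>n. f n ^ k)"
  by (induction k) (auto intro: polybd_mult polybd_const simp del: One_nat_def)

text \<open>Since \<open>2 ^ length (str n) \<le> n + 1\<close>, time exponential in the length is
  polynomial in the index. This is what makes the time bound of the reduction usable.\<close>

lemma polybd_exp_length: "polybd (\<lambda>n. 2 ^ (c * length (str n)))"
proof -
  have "polybd (\<lambda>n. (n + 1) ^ c)"
    by (intro polybd_power polybd_add polybd_id polybd_const)
  then show ?thesis
  proof (rule polybd_mono)
    fix n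
    have "(2::nat) ^ (c * length (str n)) = (2 ^ length (str n)) ^ c"
      by (metis power_mult mult.commute)
    also have "\<dots> \<le> (n + 1) ^ c" by (rule power_mono[OF length_str_lower]) simp
    finally show "(2::nat) ^ (c * length (str n)) \<le> (n + 1) ^ c" .
  qed
qed

lemma polybd_length: "polybd (\<lambda>n. length (str n))"
  by (rule polybd_mono[OF polybd_exp_length[of 1]]) (simp add: less_imp_le)

lemmas polybd_intros =
  polybd_const polybd_id polybd_mult polybd_add polybd_power polybd_exp_length polybd_length

section \<open>Machines and programs for predictors\<close>

definition answer :: "nat list \<Rightarrow> real \<Rightarrow> bool" where
  "answer out p \<longleftrightarrow> (\<exists>u v. out = enc_str u @ [3] @ enc_str v \<and> 0 < bval v \<and>
     p = real (bval u) / real (bval v))"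

lemma answer_symbols: "answer out p \<Longrightarrow> set out \<subseteq> {1..<4}"
  by (auto simp: answer_def dest!: enc_str_symbols)

text \<open>Stated for strings instead of indices, because the machines will be run at
  \<open>f x\<close> or at a preimage.\<close>

definition tm_predicts :: "tm \<Rightarrow> nat \<Rightarrow> (bool list \<Rightarrow> bool \<Rightarrow> real) \<Rightarrow> bool" where
  "tm_predicts \<delta> k P \<longleftrightarrow> (\<forall>x b. \<exists>t \<le> (sidx x + 2) ^ k.
     tm_halted (tm_run \<delta> (enc_str x @ [3, enc_bit b]) t) \<and>
     answer (tm_output (tm_run \<delta> (enc_str x @ [3, enc_bit b]) t)) (P x b))"

lemma input_symbols: "set (enc_str x @ [3, enc_bit b]) \<subseteq> {..<4}"
  by (auto simp: enc_bit_def dest!: enc_str_symbols)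

lemma poly_predictor_tm:
  assumes "poly_predictor P"
  obtains \<delta> N k where "4 \<le> N" "bounded_tm N \<delta>" "tm_predicts \<delta> k P"
proof -
  from assms obtain \<delta> k where v: "valid_tm \<delta>" and
    run: "\<forall>n b. \<exists>t \<le> (n + 2) ^ k.
           tm_halted (tm_run \<delta> (enc_str (str n) @ [3, enc_bit b]) t) \<and>
           answer (tm_output (tm_run \<delta> (enc_str (str n) @ [3, enc_bit b]) t)) (P (str n) b)"
    unfolding poly_predictor_def answer_def by blast
  obtain \<delta>' N where N: "4 \<le> N" "bounded_tm N \<delta>'"
    "\<And>w t. set w \<subseteq> {..<4} \<Longrightarrow> tm_run \<delta>' w t = tm_run \<delta> w t"
    using valid_tm_bounded[OF v] by blast
  have "tm_predicts \<delta>' k P"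
    unfolding tm_predicts_def
  proof (intro allI)
    fix x b
    show "\<exists>t \<le> (sidx x + 2) ^ k. tm_halted (tm_run \<delta>' (enc_str x @ [3, enc_bit b]) t) \<and>
       answer (tm_output (tm_run \<delta>' (enc_str x @ [3, enc_bit b]) t)) (P x b)"
      using run[rule_format, of "sidx x" b] unfolding str_sidx N(3)[OF input_symbols] .
  qed
  with N show ?thesis using that by blast
qed

text \<open>The interface between programs and predictors: from here on only commands and their time
  bounds \<open>B\<close> matter, and compilation preserves the step count.\<close>

lemma predictorI:
  fixes c :: prog
  assumes rng: "\<And>x b. 0 \<le> P x b \<and> P x b \<le> 1" "\<And>x. P x False + P x True = 1"
    and N: "4 \<le> N" and c: "wf_cmd (regs N) (cells N) c" "c \<noteq> Skip" and B: "polybd B"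
    and run: "\<And>n b. \<exists>r tp h out.
      exec c (\<lparr>st = 0, sym = 0, flag = 0\<rparr>, \<lambda>i. plain (tape_of (enc_str (str n) @ [3, enc_bit b]) i), 0)
        (B n) (r, tp, h) \<and>
      (\<forall>i<length out. tp (int i) = plain (out ! i)) \<and> tp (int (length out)) = plain 0 \<and>
      answer out (P (str n) b)"
  shows "poly_predictor P"
proof -
  have plain: "inj_on plain {..<4}" "plain ` {..<4} \<subseteq> cells N"
    using N by (auto simp: inj_on_def plain_def cells_iff)
  have r0: "\<lparr>st = 0, sym = 0, flag = 0\<rparr> \<in> regs N" using N by (simp add: regs_iff)
  obtain \<delta> where v: "valid_tm \<delta>" and
    \<delta>: "\<forall>w t r tp h. set w \<subseteq> {..<4} \<longrightarrow>
      exec c (\<lparr>st = 0, sym = 0, flag = 0\<rparr>, \<lambda>i. plain (tape_of w i), 0) t (r, tp, h) \<longrightarrow>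
      tm_halted (tm_run \<delta> w t) \<and>
      (\<forall>out. set out \<subseteq> {1..<4} \<longrightarrow> (\<forall>i<length out. tp (int i) = plain (out ! i)) \<longrightarrow>
          tp (int (length out)) = plain 0 \<longrightarrow> tm_output (tm_run \<delta> w t) = out)"
    using compile_cmd[OF finite_regs finite_cells c(1) r0 plain c(2)] by (elim exE conjE)
  obtain k where k: "\<forall>n. B n \<le> (n + 2) ^ k" using B unfolding polybd_def by blast
  have "\<exists>t \<le> (n + 2) ^ k. tm_halted (tm_run \<delta> (enc_str (str n) @ [3, enc_bit b]) t) \<and>
      answer (tm_output (tm_run \<delta> (enc_str (str n) @ [3, enc_bit b]) t)) (P (str n) b)" for n b
  proof -
    obtain r tp h out where
      e: "exec c (\<lparr>st = 0, sym = 0, flag = 0\<rparr>, \<lambda>i. plain (tape_of (enc_str (str n) @ [3, enc_bit b]) i), 0)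
        (B n) (r, tp, h)" and o: "\<forall>i<length out. tp (int i) = plain (out ! i)"
      "tp (int (length out)) = plain 0" "answer out (P (str n) b)"
      using run by blast
    show ?thesis
      using \<delta>[rule_format, OF input_symbols e] o answer_symbols[OF o(3)] k[rule_format, of n]
      by (intro exI[of _ "B n"]) auto
  qed
  then show ?thesis
    unfolding poly_predictor_def using rng v unfolding answer_def by blast
qed

definition tm_computes :: "tm \<Rightarrow> nat \<Rightarrow> (bool list \<Rightarrow> bool list) \<Rightarrow> bool" where
  "tm_computes \<delta> c f \<longleftrightarrow> (\<forall>x. \<exists>t \<le> 2 ^ (c * length x).
     tm_halted (tm_run \<delta> (enc_str x) t) \<and> tm_output (tm_run \<delta> (enc_str x) t) = enc_str (f x))"

lemma enc_str_nz: "0 \<notin> set (enc_str u)" "3 \<notin> set (enc_str u)"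
  using enc_str_symbols[of 0 u] enc_str_symbols[of 3 u] by auto

text \<open>The machine for \<open>P\<close> runs on \<open>f x\<close> in time polynomial in
  \<open>sidx (f x)\<close>. The length bound keeps this index below
  \<open>2 ^ (c * length x + 1)\<close>, hence polynomial in \<open>sidx x\<close>.\<close>

lemma predictor_comp:
  assumes P: "poly_predictor P" and M: "4 \<le> M" "bounded_tm M \<phi>" "tm_computes \<phi> c f"
    and len: "\<And>x. length (f x) \<le> c * length x"
  shows "poly_predictor (\<lambda>x. P (f x))"
proof -
  obtain \<delta> K k where \<delta>: "4 \<le> K" "bounded_tm K \<delta>" "tm_predicts \<delta> k P"
    using poly_predictor_tm[OF P] .
  define N where "N = max M K"
  have N: "4 \<le> N" "bounded_tm N \<phi>" "bounded_tm N \<delta>"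
    using M \<delta> bounded_tm_mono unfolding N_def by auto
  let ?c = "read_input ;; eval_on \<phi> inp False ;; store ;; clean ;; eval_on \<delta> ctr True ;; emit"
  \<comment> \<open>\<open>?B1\<close> and \<open>?B2\<close> bound input length plus running time
    of the two simulated machines; they instantiate \<open>B\<close> in
    \<open>exec_eval_on\<close>.\<close>
  let ?B1 = "\<lambda>n. length (str n) + 2 ^ (c * length (str n))"
  let ?B2 = "\<lambda>n. c * length (str n) + 2 + (2 * 2 ^ (c * length (str n)) + 2) ^ k"
  show ?thesis
  proof (rule predictorI[where N = N and c = ?c and B = "\<lambda>n. 50 * (?B1 n + ?B2 n) + 250"])
    show "wf_cmd (regs N) (cells N) ?c"
      using wf_read_input wf_eval_on wf_store wf_clean wf_emit N by (simp add: cells_iff)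
    show "polybd (\<lambda>n. 50 * (?B1 n + ?B2 n) + 250)" by (intro polybd_intros)
    show "0 \<le> P (f x) b \<and> P (f x) b \<le> 1" "P (f x) False + P (f x) True = 1" for x b
      using P unfolding poly_predictor_def by auto
    fix n b
    define x where "x = str n"
    define y where "y = f x"
    let ?b = "enc_bit b"
    obtain t where t: "t \<le> 2 ^ (c * length x)" "tm_halted (tm_run \<phi> (enc_str x) t)"
      "tm_output (tm_run \<phi> (enc_str x) t) = enc_str y"
      using M(3) unfolding tm_computes_def y_def by blast
    obtain t' where t': "t' \<le> (sidx y + 2) ^ k" "tm_halted (tm_run \<delta> (enc_str y @ [3, ?b]) t')"
      "answer (tm_output (tm_run \<delta> (enc_str y @ [3, ?b]) t')) (P y b)"
      using \<delta>(3) unfolding tm_predicts_def by blast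
    have ly: "length y \<le> c * length x" unfolding y_def by (rule len)
    have "sidx y + 1 < 2 ^ (length y + 1)" by (rule sidx_upper)
    also have "\<dots> \<le> 2 ^ (c * length x + 1)" using ly by (intro power_increasing) auto
    finally have "(sidx y + 2) ^ k \<le> (2 * 2 ^ (c * length x) + 2) ^ k" by (intro power_mono) auto
    with t'(1) have t'B: "t' \<le> (2 * 2 ^ (c * length x) + 2) ^ k" by linarith
    let ?I = "tape_of (enc_str x)" and ?Y = "tape_of (enc_str y)" and ?r0 = "\<lparr>st = 0, sym = 0, flag = 0\<rparr>"
    let ?r1 = "?r0\<lparr>sym := ?b\<rparr>" and ?r2 = "\<lparr>st = 1, sym = ?b, flag = 0\<rparr>"
    note e1 = exec_read_input[OF enc_str_nz(2), of ?r0 x ?b]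
    obtain W l m where lm: "l \<le> 0" "0 \<le> m" "- l \<le> int (?B1 n) + 1" "m \<le> int (?B1 n) + 1"
        "\<forall>i. i \<notin> {l..m} \<longrightarrow> W i = 0" and hold: "holds W (enc_str y)"
      and e2: "exec (eval_on \<phi> inp False) (?r1, mk ?I (\<lambda>_. 0) (\<lambda>_. 0) {}, 0) (18 * ?B1 n + 50)
        (?r2, mk ?I (\<lambda>_. 0) W {l..m}, 0)"
      using exec_eval_on[OF N(2) t(2) enc_str_nz(1), of inp ?I "\<lambda>_. 0" x False ?r1 "?B1 n"] t(1,3)
      unfolding x_def by auto
    note e3 = exec_store[OF hold, of ?r2 ?I "{l..m}"]
    note e4 = exec_clean[OF lm, of ?r2 ?I ?Y]
    obtain W' l' m' where lm': "l' \<le> 0" "0 \<le> m'" "- l' \<le> int (?B2 n) + 1" "m' \<le> int (?B2 n) + 1"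
        "\<forall>i. i \<notin> {l'..m'} \<longrightarrow> W' i = 0"
      and hold': "holds W' (tm_output (tm_run \<delta> (enc_str y @ [3, ?b]) t'))"
      and e5: "exec (eval_on \<delta> ctr True) (?r2, mk ?I ?Y (\<lambda>_. 0) {}, 0) (18 * ?B2 n + 50)
        (?r2, mk ?I ?Y W' {l'..m'}, 0)"
      using exec_eval_on[OF N(3) t'(2) enc_str_nz(1), of ctr ?I ?Y y True ?r2 "?B2 n"] t'B ly
      unfolding x_def by auto
    let ?out = "tm_output (tm_run \<delta> (enc_str y @ [3, ?b]) t')"
    obtain tp h where e6: "exec emit (?r2, mk ?I ?Y W' {l'..m'}, 0) (3 * length ?out + 3) (?r2, tp, h)"
      and tp: "\<forall>i<length ?out. tp (int i) = plain (?out ! i)" "tp (int (length ?out)) = plain 0"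
      using exec_emit[OF hold'] by blast
    have "length (enc_str y) \<le> ?B1 n + 2" "length ?out \<le> ?B2 n + 2"
      using holds_length[OF hold lm(5,2,4)] holds_length[OF hold' lm'(5,2,4)] .
    then have "exec ?c (?r0, \<lambda>i. plain (tape_of (enc_str x @ [3, ?b]) i), 0)
        (50 * (?B1 n + ?B2 n) + 250) (?r2, tp, h)"
      by (intro exec_mono[OF exec_Seq[OF e1 exec_Seq[OF e2 exec_Seq[OF e3 exec_Seq[OF e4
        exec_Seq[OF e5 e6 order_refl] order_refl] order_refl] order_refl] order_refl]])
        (simp add: x_def)
    then show "\<exists>r tp h out. exec ?c (?r0, \<lambda>i. plain (tape_of (enc_str (str n) @ [3, ?b]) i), 0)
        (50 * (?B1 n + ?B2 n) + 250) (r, tp, h) \<and>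
        (\<forall>i<length out. tp (int i) = plain (out ! i)) \<and> tp (int (length out)) = plain 0 \<and>
        answer out (P (f (str n)) b)"
      using tp t'(3) unfolding y_def x_def by blast
  qed (use N in simp_all)
qed

text \<open>Since \<open>f\<close> does not shorten strings, a preimage of \<open>z\<close> can be found among the
  strings of length at most \<open>length z\<close>, whose number is polynomial in the index of \<open>z\<close>.\<close>

lemma predictor_glue:
  assumes P: "poly_predictor P" and Q: "poly_predictor Q"
    and M: "4 \<le> M" "bounded_tm M \<phi>" "tm_computes \<phi> c f"
    and f: "inj f" "\<And>x. length x \<le> length (f x)"
  shows "poly_predictor (\<lambda>z. if z \<in> range f then Q (inv f z) else P z)"
proof -
  obtain \<delta> K k where \<delta>: "4 \<le> K" "bounded_tm K \<delta>" "tm_predicts \<delta> k P"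
    using poly_predictor_tm[OF P] .
  obtain \<gamma> K' k' where \<gamma>: "4 \<le> K'" "bounded_tm K' \<gamma>" "tm_predicts \<gamma> k' Q"
    using poly_predictor_tm[OF Q] .
  define N where "N = max M (max K K')"
  have N: "4 \<le> N" "bounded_tm N \<phi>" "bounded_tm N \<delta>" "bounded_tm N \<gamma>"
    using M \<delta> \<gamma> bounded_tm_mono unfolding N_def by auto
  let ?R = "\<lambda>z. if z \<in> range f then Q (inv f z) else P z"
  let ?c = "read_input ;; search \<phi> ;;
    Cond (\<lambda>r a. flag r = 1) (eval_on \<gamma> ctr True) (eval_on \<delta> inp True) ;; emit"
  \<comment> \<open>\<open>?B1\<close> is the bound of \<open>exec_search\<close> for a start at the
    empty string. \<open>?B2\<close> adds the times of both predictors so as to cover either branch.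
    Writing \<open>1 * length\<close> makes \<open>polybd_exp_length\<close> applicable.\<close>
  let ?B1 = "\<lambda>n. (42 * (length (str n) + 2 ^ (c * length (str n))) + 152) * (2 * 2 ^ (1 * length (str n))) + 1"
  let ?B2 = "\<lambda>n. length (str n) + 2 + ((2 * 2 ^ (1 * length (str n)) + 2) ^ k' + (n + 2) ^ k)"
  show ?thesis
  proof (rule predictorI[where N = N and c = ?c and B = "\<lambda>n. 6 * length (str n) + ?B1 n + 21 * ?B2 n + 100"])
    show "wf_cmd (regs N) (cells N) ?c"
      using wf_read_input wf_eval_on wf_search wf_emit N by (simp add: cells_iff)
    show "polybd (\<lambda>n. 6 * length (str n) + ?B1 n + 21 * ?B2 n + 100)" by (intro polybd_intros)
    show "0 \<le> ?R z b \<and> ?R z b \<le> 1" "?R z False + ?R z True = 1" for z b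
      using P Q unfolding poly_predictor_def by auto
    fix n b
    define z where "z = str n"
    let ?T = "2 ^ (c * length z)" and ?b = "enc_bit b"
    let ?I = "tape_of (enc_str z)" and ?r0 = "\<lparr>st = 0, sym = 0, flag = 0\<rparr>"
    let ?r1 = "?r0\<lparr>sym := ?b\<rparr>"
    \<comment> \<open>A blank counter track already encodes the empty string, the first
      candidate.\<close>
    have X0: "(\<lambda>_. 0) = tape_of (enc_str [])" by (auto simp: tape_of_def enc_str_def)
    have run: "\<exists>t\<le>?T. tm_halted (tm_run \<phi> (enc_str x) t) \<and>
        tm_output (tm_run \<phi> (enc_str x) t) = enc_str (f x)" if "length x \<le> length z" for x
    proof -
      have "(2::nat) ^ (c * length x) \<le> ?T" using that by (intro power_increasing) auto
      then show ?thesis using M(3) unfolding tm_computes_def by (meson order_trans)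
    qed
    note e1 = exec_read_input[OF enc_str_nz(2), of ?r0 z ?b]
    obtain X r where r: "sym r = ?b" and
      e2: "exec (search \<phi>) (?r1, mk ?I (\<lambda>_. 0) (\<lambda>_. 0) {}, 0) (?B1 n) (r, mk ?I X (\<lambda>_. 0) {}, 0)"
      and found: "(\<exists>y. f y = z \<and> length y \<le> length z \<and> flag r = 1 \<and> X = tape_of (enc_str y)) \<or>
        (flag r = 2 \<and> (\<forall>y. length y \<le> length z \<longrightarrow> f y \<noteq> z))"
      using exec_search[OF N(2) run, of z "[]" ?r1] unfolding X0[symmetric] by (auto simp: z_def)
    \<comment> \<open>Both outcomes are brought into one form: machine \<open>\<beta>\<close> is to
      run on the string \<open>u\<close> that stands on track \<open>sel\<close>, the preimage on
      \<open>ctr\<close> or \<open>z\<close> itself on \<open>inp\<close>.\<close>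
    obtain t \<beta> u sel where t: "bounded_tm N \<beta>" "length u + 2 + t \<le> ?B2 n"
      "tm_halted (tm_run \<beta> (enc_str u @ [3, ?b]) t)"
      "answer (tm_output (tm_run \<beta> (enc_str u @ [3, ?b]) t)) (?R z b)"
      and sel: "\<And>W V i. sel (mk ?I X W V i) = tape_of (enc_str u) i"
      and cond: "eval_on \<beta> sel True = (if flag r = 1 then eval_on \<gamma> ctr True else eval_on \<delta> inp True)"
    proof -
      from found consider y where "f y = z" "length y \<le> length z" "flag r = 1" "X = tape_of (enc_str y)"
        | "flag r = 2" "\<forall>y. length y \<le> length z \<longrightarrow> f y \<noteq> z" by blast
      then show ?thesis
      proof cases
        case 1
        obtain t where t: "t \<le> (sidx y + 2) ^ k'" "tm_halted (tm_run \<gamma> (enc_str y @ [3, ?b]) t)"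
          "answer (tm_output (tm_run \<gamma> (enc_str y @ [3, ?b]) t)) (Q y b)"
          using \<gamma>(3) unfolding tm_predicts_def by blast
        have "sidx y + 1 < 2 ^ (length y + 1)" by (rule sidx_upper)
        also have "\<dots> \<le> 2 ^ (length z + 1)" using 1(2) by (intro power_increasing) auto
        finally have "(sidx y + 2) ^ k' \<le> (2 * 2 ^ (1 * length z) + 2) ^ k'" by (intro power_mono) auto
        then have "length y + 2 + t \<le> ?B2 n" using t(1) 1(2) unfolding z_def by linarith
        moreover have "?R z b = Q y b" using f(1) unfolding 1(1)[symmetric] by simp
        ultimately show ?thesis using that[of \<gamma> y t ctr] N(4) t 1(3,4) by simp
      next
        case 2
        obtain t where t: "t \<le> (n + 2) ^ k" "tm_halted (tm_run \<delta> (enc_str z @ [3, ?b]) t)"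
          "answer (tm_output (tm_run \<delta> (enc_str z @ [3, ?b]) t)) (P z b)"
          using \<delta>(3) sidx_str[of n] unfolding tm_predicts_def z_def by metis
        have "z \<notin> range f" using 2(2) f(2) by auto
        then have "?R z b = P z b" by simp
        moreover have "length z + 2 + t \<le> ?B2 n" using t(1) unfolding z_def by linarith
        ultimately show ?thesis using that[of \<delta> z t inp] N(3) t 2(1) by simp
      qed
    qed
    let ?r2 = "r\<lparr>st := 1\<rparr>"
    obtain W l m where lm: "l \<le> 0" "0 \<le> m" "- l \<le> int (?B2 n) + 1" "m \<le> int (?B2 n) + 1"
        "\<forall>i. i \<notin> {l..m} \<longrightarrow> W i = 0" and hold: "holds W (tm_output (tm_run \<beta> (enc_str u @ [3, ?b]) t))"
      and e: "exec (eval_on \<beta> sel True) (r, mk ?I X (\<lambda>_. 0) {}, 0) (18 * ?B2 n + 50)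
        (?r2, mk ?I X W {l..m}, 0)"
      using exec_eval_on[OF t(1,3) enc_str_nz(1) sel, where suf = True and r = r and B = "?B2 n"] t(2) r
      by auto
    have e3: "exec (Cond (\<lambda>r a. flag r = 1) (eval_on \<gamma> ctr True) (eval_on \<delta> inp True))
        (r, mk ?I X (\<lambda>_. 0) {}, 0) (18 * ?B2 n + 50 + 1) (?r2, mk ?I X W {l..m}, 0)"
      by (rule exec_Cond) (use e cond in \<open>auto split: if_splits\<close>)
    let ?out = "tm_output (tm_run \<beta> (enc_str u @ [3, ?b]) t)"
    obtain tp h where e4: "exec emit (?r2, mk ?I X W {l..m}, 0) (3 * length ?out + 3) (?r2, tp, h)"
      and tp: "\<forall>i<length ?out. tp (int i) = plain (?out ! i)" "tp (int (length ?out)) = plain 0"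
      using exec_emit[OF hold] by blast
    have "length ?out \<le> ?B2 n + 2" using holds_length[OF hold lm(5,2,4)] .
    then have "exec ?c (?r0, \<lambda>i. plain (tape_of (enc_str z @ [3, ?b]) i), 0)
        (6 * length (str n) + ?B1 n + 21 * ?B2 n + 100) (?r2, tp, h)"
      by (intro exec_mono[OF exec_Seq[OF e1 exec_Seq[OF e2
        exec_Seq[OF e3 e4 order_refl] order_refl] order_refl]]) (simp add: z_def)
    then show "\<exists>r tp h out. exec ?c (?r0, \<lambda>i. plain (tape_of (enc_str (str n) @ [3, ?b]) i), 0)
        (6 * length (str n) + ?B1 n + 21 * ?B2 n + 100) (r, tp, h) \<and>
        (\<forall>i<length out. tp (int i) = plain (out ! i)) \<and> tp (int (length out)) = plain 0 \<and>
        answer out (?R (str n) b)"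
      using tp t(4) unfolding z_def by blast
  qed (use N in simp_all)
qed

section \<open>Transferring deepness\<close>

text \<open>Outside the range of \<open>f\<close> both predictors on \<open>L2\<close> agree and
  contribute the same product. A common factor is claimed instead of equal quotients because that
  product can be zero.\<close>

lemma pom_glue:
  fixes f L1 L2 P Q Q' n
  assumes mono: "\<And>x y. llex_less x y \<Longrightarrow> llex_less (f x) (f y)"
    and L: "\<And>x. x \<in> L1 \<longleftrightarrow> f x \<in> L2"
  defines "P' \<equiv> (\<lambda>z. if z \<in> range f then Q (inv f z) else P z)" and "m \<equiv> sidx (f (str n))"
  shows "\<exists>c. pom P L2 m = c * pom (\<lambda>x. P (f x)) L1 n \<and> pom P' L2 m = c * pom Q L1 n"
proof -
  let ?g = "\<lambda>j. sidx (f (str j))"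
  have g: "strict_mono ?g"
    by (rule strict_monoI) (metis mono sidx_less_iff sidx_str)
  have inj: "inj f"
    by (rule injI) (metis mono llex_linear llex_irrefl)
  define G where "G = ?g ` {..<n}"
  have G: "G \<subseteq> {..<m}" "finite G"
    unfolding G_def m_def using strict_monoD[OF g] by auto
  have out: "str i \<notin> range f" if "i \<in> {..<m} - G" for i
  proof
    assume "str i \<in> range f"
    then obtain x where x: "str i = f x" by auto
    then have i: "i = ?g (sidx x)" by (metis sidx_str str_sidx)
    have "sidx x < n"
      using that strict_mono_less[OF g, of "sidx x" n] i unfolding m_def by simp
    then show False using that i unfolding G_def by blast
  qed
  let ?r = "\<Prod>i\<in>{..<m} - G. P (str i) (str i \<in> L2)"
  have split: "(\<Prod>i<m. F i) = (\<Prod>i\<in>{..<m} - G. F i) * (\<Prod>j<n. F (?g j))" for F :: "nat \<Rightarrow> real"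
  proof -
    have "(\<Prod>i\<in>G. F i) = (\<Prod>j<n. F (?g j))"
      unfolding G_def by (rule prod.reindex[unfolded o_def])
        (use strict_mono_imp_inj_on[OF g] inj_on_subset in blast)
    then show ?thesis using prod.subset_diff[OF G(1), of F] by simp
  qed
  have rest: "(\<Prod>i\<in>{..<m} - G. P' (str i) (str i \<in> L2)) = ?r"
    by (rule prod.cong) (use out in \<open>auto simp: P'_def\<close>)
  have P1: "(\<Prod>j<n. P (str (?g j)) (str (?g j) \<in> L2)) = (\<Prod>j<n. P (f (str j)) (str j \<in> L1))"
    by (simp add: L)
  have P2: "(\<Prod>j<n. P' (str (?g j)) (str (?g j) \<in> L2)) = (\<Prod>j<n. Q (str j) (str j \<in> L1))"
    by (simp add: L P'_def inj)
  have "n \<le> m" unfolding m_def using strict_mono_imp_increasing[OF g] .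
  then have pow: "(2::real) ^ m = 2 ^ (m - n) * 2 ^ n" by (simp flip: power_add)
  show ?thesis
    by (intro exI[of _ "2 ^ (m - n) * ?r"] conjI)
      (simp_all only: pom_def split P1 P2 rest pow mult_ac)
qed

text \<open>For \<open>n \<ge> 2\<close>, the estimate
  \<open>2 ^ length (str n) \<le> n + 1 \<le> n ^ 2\<close> turns the length bound into
  \<open>n ^ (2 * c)\<close>. The spare factor 2 of \<open>sidx_upper\<close> costs one more
  \<open>n\<close>, whence \<open>2 * c + 1\<close>.\<close>

lemma log_sidx_image_le:
  assumes len: "length (f (str n)) \<le> c * length (str n)" and n: "2 \<le> n"
  shows "log 2 (real (sidx (f (str n)))) \<le> (2 * real c + 1) * log 2 (real n)"
proof (cases "sidx (f (str n)) = 0")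
  \<comment> \<open>Here the logarithm takes its default value \<open>ln 0 = 0\<close>.\<close>
  case True
  then show ?thesis using n by (simp add: log_def)
next
  case False
  let ?m = "sidx (f (str n))"
  have "?m \<le> 2 ^ (length (f (str n)) + 1)" using sidx_upper[of "f (str n)"] by linarith
  also have "\<dots> \<le> 2 ^ (c * length (str n) + 1)" using len by (intro power_increasing) auto
  also have "\<dots> = (2 ^ length (str n)) ^ c * 2" by (simp add: power_mult[symmetric] mult.commute)
  also have "\<dots> \<le> (n ^ 2) ^ c * n"
  proof (intro mult_le_mono power_mono)
    have "2 * n \<le> n * n" using n by (intro mult_le_mono1)
    then show "2 ^ length (str n) \<le> n ^ 2"
      using length_str_lower[of n] n unfolding power2_eq_square by linarith
  qed (use n in auto)
  also have "\<dots> = n ^ (2 * c + 1)" by (simp add: power_mult[symmetric])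
  finally have "real ?m \<le> real n ^ (2 * c + 1)" by (metis of_nat_le_iff of_nat_power)
  then have "log 2 (real ?m) \<le> log 2 (real n ^ (2 * c + 1))" using False by simp
  also have "\<dots> = real (2 * c + 1) * log 2 (real n)" using n by (subst log_nat_power) auto
  finally show ?thesis by (simp add: add.commute)
qed

theorem theorem4:
  fixes L1 L2 :: "bool list set"
  assumes "M_reduces_E_Lb L1 L2"
    and "poly_deep L1"
  shows "poly_deep L2"
proof -
  obtain c \<delta> f where v: "valid_tm \<delta>" and mono: "\<And>x y. llex_less x y \<Longrightarrow> llex_less (f x) (f y)"
    and len: "\<And>x. length (f x) \<le> c * length x" and
    comp: "\<And>x. \<exists>s \<le> 2 ^ (c * length x). tm_halted (tm_run \<delta> (enc_str x) s) \<and>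
            tm_output (tm_run \<delta> (enc_str x) s) = enc_str (f x)"
    and L: "\<And>x. x \<in> L1 \<longleftrightarrow> f x \<in> L2"
    using assms(1) unfolding M_reduces_E_Lb_def M_reduces_def by metis
  obtain \<phi> M where \<phi>: "4 \<le> M" "bounded_tm M \<phi>"
    "\<And>w t. set w \<subseteq> {..<4} \<Longrightarrow> tm_run \<phi> w t = tm_run \<delta> w t"
    using valid_tm_bounded[OF v] by blast
  have "tm_run \<phi> (enc_str x) t = tm_run \<delta> (enc_str x) t" for x t
    by (rule \<phi>(3)) (use enc_str_symbols in force)
  with comp have M: "tm_computes \<phi> c f" unfolding tm_computes_def by simp
  have inj: "inj f" by (rule injI) (metis mono llex_linear llex_irrefl)
  have grow: "length x \<le> length (f x)" for x using mono_le_self(2)[of f x] mono by blast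
  have g: "strict_mono (\<lambda>n. sidx (f (str n)))"
    by (rule strict_monoI) (metis mono sidx_less_iff sidx_str)
  obtain a where a: "a > 0" and deep: "\<And>P. poly_predictor P \<Longrightarrow> \<exists>P'. poly_predictor P' \<and>
      infinite {n. pom P L1 n = 0 \<or> pom P' L1 n / pom P L1 n \<ge> a * log 2 (real n)}"
    using assms(2) unfolding poly_deep_def by blast
  \<comment> \<open>Dividing by the constant of \<open>log_sidx_image_le\<close> makes up for
    passing from \<open>n\<close> to the larger index of \<open>f (str n)\<close>; the result
    depends on the reduction and on \<open>a\<close>, not on \<open>P\<close>.\<close>
  define b where "b = a / (2 * real c + 1)"
  show ?thesis unfolding poly_deep_def
  proof (intro exI[of _ b] conjI allI impI)
    show "b > 0" unfolding b_def using a by simp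
    fix P assume P: "poly_predictor P"
    obtain Q where Q: "poly_predictor Q" and inf:
      "infinite {n. pom (\<lambda>x. P (f x)) L1 n = 0 \<or>
         pom Q L1 n / pom (\<lambda>x. P (f x)) L1 n \<ge> a * log 2 (real n)}" (is "infinite ?N")
      using deep[OF predictor_comp[OF P \<phi>(1,2) M len]] by blast
    let ?P' = "\<lambda>z. if z \<in> range f then Q (inv f z) else P z"
    let ?g = "\<lambda>n. sidx (f (str n))"
    \<comment> \<open>Indices below 2 are removed to meet the hypothesis of
      \<open>log_sidx_image_le\<close>.\<close>
    have "?g ` (?N - {..<2}) \<subseteq>
      {m. pom P L2 m = 0 \<or> pom ?P' L2 m / pom P L2 m \<ge> b * log 2 (real m)}"
    proof (rule image_subsetI)
      fix n assume n: "n \<in> ?N - {..<2}"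
      obtain e where e: "pom P L2 (?g n) = e * pom (\<lambda>x. P (f x)) L1 n"
        "pom ?P' L2 (?g n) = e * pom Q L1 n"
        using pom_glue[OF mono L, of P n Q] by blast
      have "b * log 2 (real (?g n)) \<le> pom ?P' L2 (?g n) / pom P L2 (?g n)" if nz: "pom P L2 (?g n) \<noteq> 0"
      proof -
        have "b * log 2 (real (?g n)) \<le> b * ((2 * real c + 1) * log 2 (real n))"
          using log_sidx_image_le[of f n c, OF len] n \<open>b > 0\<close> by (intro mult_left_mono) auto
        also have "\<dots> = a * log 2 (real n)"
          by (simp add: b_def add_pos_nonneg add_nonneg_eq_0_iff)
        \<comment> \<open>By \<open>e(1)\<close>, \<open>nz\<close> makes both \<open>e\<close> and
          the martingale of \<open>P \<circ> f\<close> nonzero at \<open>n\<close>. So membership in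
          \<open>?N\<close> gives the quotient bound, and \<open>e\<close> cancels in the next
          step.\<close>
        also have "\<dots> \<le> pom Q L1 n / pom (\<lambda>x. P (f x)) L1 n" using n nz e(1) by auto
        also have "\<dots> = pom ?P' L2 (?g n) / pom P L2 (?g n)" using nz unfolding e by simp
        finally show ?thesis .
      qed
      then show "?g n \<in> {m. pom P L2 m = 0 \<or> pom ?P' L2 m / pom P L2 m \<ge> b * log 2 (real m)}"
        by blast
    qed
    \<comment> \<open>Infinitely many good indices for \<open>L1\<close> stay infinitely many for
      \<open>L2\<close>, as \<open>?g\<close> is injective.\<close>
    moreover have "infinite (?g ` (?N - {..<2}))"
    proof
      assume "finite (?g ` (?N - {..<2}))"
      then have "finite (?N - {..<2})"
        by (rule finite_imageD[OF _ strict_mono_imp_inj_on[OF g]])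
      with inf show False using Diff_infinite_finite[of "{..<2}" ?N] by blast
    qed
    ultimately have "infinite {m. pom P L2 m = 0 \<or> pom ?P' L2 m / pom P L2 m \<ge> b * log 2 (real m)}"
      by (rule infinite_super)
    then show "\<exists>P'. poly_predictor P' \<and>
      infinite {n. pom P L2 n = 0 \<or> pom P' L2 n / pom P L2 n \<ge> b * log 2 (real n)}"
      using predictor_glue[OF P Q \<phi>(1,2) M inj grow] by blast
  qed
qed

end
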